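(* Let $q\in C[-b,b]$ be complex valued, let $f$ be a solution of $f''=qf$ on $[-b,b]$ with $f\neq0$ on $[-b,b]$, $f(0)=1$, and $h:=f'(0)$. Suppose that there exist $p\in\mathbb{N}$ and constants $\delta>0$ and $c_p>0$ such that for each $N\in\mathbb{N}$ there exist complex constants $a_0^{(N)},\ldots,a_N^{(N)},b_1^{(N)},\ldots,b_N^{(N)}$ and numbers $\varepsilon_1,\varepsilon_2$ (depending on $N$) with $$\left|\frac h2+\frac14\int_0^xq(s)\,ds-\sum_{n=0}^Na_n^{(N)}\mathbf{c}_n(x)\right|<\varepsilon_1,\qquad\left|\frac14\int_0^xq(s)\,ds-\sum_{n=1}^Nb_n^{(N)}\mathbf{s}_n(x)\right|<\varepsilon_2\qquad\text{for every }x\in[-b,b],$$ and $$\max\{\varepsilon_1,\varepsilon_2\}\le\frac{c_p}{N^{p+1+\delta}}.$$ Then $q\in C^p(-b,b)$.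
   Context: $\mathbb{N}=\{1,2,\ldots\}$. Functions $\varphi_k$ on $[-b,b]$: $X^{(0)}\equiv\widetilde X^{(0)}\equiv1$, $X^{(n)}(x)=n\int_0^x X^{(n-1)}(s)\left(f^2(s)\right)^{(-1)^n}ds$, $\widetilde X^{(n)}(x)=n\int_0^x \widetilde X^{(n-1)}(s)\left(f^2(s)\right)^{(-1)^{n-1}}ds$ for $n\ge1$; $\varphi_k=fX^{(k)}$ for $k$ odd, $\varphi_k=f\widetilde X^{(k)}$ for $k$ even. Then $\mathbf{c}_0=f$, $\mathbf{s}_0\equiv0$, and for $m\ge1$, $\mathbf{c}_m(x)=\sum_{\text{even }k=0}^m\binom mk x^k\varphi_{m-k}(x)$, $\mathbf{s}_m(x)=\sum_{\text{odd }k=1}^m\binom mk x^k\varphi_{m-k}(x)$. *)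

theory Defs
  imports "HOL-Analysis.Analysis"
begin

text \<open>
  Recursive integrals. The interval integral \<open>LBINT s=0..x. g s\<close> is oriented, so the
  definitions also apply for negative \<open>x\<close>.
\<close>

primrec X_int :: "(real \<Rightarrow> complex) \<Rightarrow> nat \<Rightarrow> real \<Rightarrow> complex" where
  "X_int f 0 = (\<lambda>x. 1)"
| "X_int f (Suc n) = (\<lambda>x. of_nat (Suc n) *
     (LBINT s=0..x. X_int f n s * ((f s)\<^sup>2) powi ((-1) ^ Suc n)))"

primrec Xt_int :: "(real \<Rightarrow> complex) \<Rightarrow> nat \<Rightarrow> real \<Rightarrow> complex" where
  "Xt_int f 0 = (\<lambda>x. 1)"
| "Xt_int f (Suc n) = (\<lambda>x. of_nat (Suc n) *
     (LBINT s=0..x. Xt_int f n s * ((f s)\<^sup>2) powi ((-1) ^ n)))"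

definition phi :: "(real \<Rightarrow> complex) \<Rightarrow> nat \<Rightarrow> real \<Rightarrow> complex" where
  "phi f k x = (if odd k then f x * X_int f k x else f x * Xt_int f k x)"

text \<open>
  The cases \<open>m = 0\<close>, which are usually listed separately, are covered by the
  same formulas; see the two lemmas below.
\<close>

definition c_fun :: "(real \<Rightarrow> complex) \<Rightarrow> nat \<Rightarrow> real \<Rightarrow> complex" where
  "c_fun f m x = (\<Sum>k | even k \<and> k \<le> m.
     of_nat (m choose k) * of_real x ^ k * phi f (m - k) x)"

definition s_fun :: "(real \<Rightarrow> complex) \<Rightarrow> nat \<Rightarrow> real \<Rightarrow> complex" where
  "s_fun f m x = (\<Sum>k | odd k \<and> k \<le> m.
     of_nat (m choose k) * of_real x ^ k * phi f (m - k) x)"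

lemma c_fun_0: "c_fun f 0 = f"
proof
  fix x
  have "{k::nat. even k \<and> k \<le> 0} = {0}" by auto
  then show "c_fun f 0 x = f x" by (simp add: c_fun_def phi_def)
qed

lemma s_fun_0: "s_fun f 0 = (\<lambda>x. 0)"
proof
  fix x
  have "{k::nat. odd k \<and> k \<le> 0} = {}" by (auto elim: oddE)
  then show "s_fun f 0 x = 0" by (simp only: s_fun_def sum.empty)
qed

text \<open>\<open>g\<close> is of class \<open>C\<^sup>k\<close> on \<open>S\<close>; \<open>S\<close> is meant to be open.\<close>

primrec Ck_on :: "nat \<Rightarrow> (real \<Rightarrow> 'a::real_normed_vector) \<Rightarrow> real set \<Rightarrow> bool" where
  "Ck_on 0 g S \<longleftrightarrow> continuous_on S g"
| "Ck_on (Suc k) g S \<longleftrightarrow>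
     (\<forall>x\<in>S. g differentiable (at x)) \<and> Ck_on k (\<lambda>x. vector_derivative g (at x)) S"

end

theory Submission
  imports Defs "HOL-Complex_Analysis.Complex_Analysis"
begin

text \<open>
  Put \<open>r = f' / f\<close>, so that \<open>r' = q - r\<^sup>2\<close>, and let \<open>\<psi>\<^sub>k\<close> be \<open>1 / f\<close> times the recursive
  integral that \<open>\<phi>\<^sub>k\<close> does not use. The recursion for the integrals becomes the first-order system
  \<open>\<phi>\<^sub>k' = r \<phi>\<^sub>k + k \<psi>\<^sub>k\<^sub>-\<^sub>1\<close>, \<open>\<psi>\<^sub>k' = - r \<psi>\<^sub>k + k \<phi>\<^sub>k\<^sub>-\<^sub>1\<close>. For a polynomial \<open>P\<close> with coefficients \<open>p\<^sub>n\<close>,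
  form \<open>\<A>(x,t)\<close> and \<open>\<B>(x,t)\<close> as the sums of \<open>p\<^sub>n (n choose j) t\<^sup>j\<close> times the half sum,
  respectively half difference, of \<open>\<phi>\<^sub>n\<^sub>-\<^sub>j(x)\<close> and \<open>\<psi>\<^sub>n\<^sub>-\<^sub>j(x)\<close>. Then
  \<open>(\<partial>\<^sub>x - \<partial>\<^sub>t) \<A> = r \<B>\<close> and \<open>(\<partial>\<^sub>x + \<partial>\<^sub>t) \<B> = r \<A>\<close>, with \<open>\<A>(0,t) = P(t)\<close> and \<open>\<B>(0,t) = 0\<close>,
  and the difference of \<open>\<A> + \<B>\<close> between the characteristics \<open>t = x\<close> and \<open>t = - x\<close> is twice the
  sum of the \<open>p\<^sub>n s\<^sub>n(x)\<close>. This system replaces the second-order wave equation with potential \<open>q\<close>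
  and its Goursat problem: \<open>r\<close> has one derivative more than \<open>q\<close>, and every estimate is an
  integration along straight lines.

  The approximation by the \<open>s\<^sub>n\<close> says that polynomials \<open>P\<^sub>N\<close> of degree at most \<open>N\<close> have characteristic
  jumps converging to the integral of \<open>q / 2\<close> at the rate \<open>N\<close> to the power \<open>- (p + 1 + \<delta>)\<close>. The jump
  at \<open>x\<close> is \<open>P(2x) - P(0)\<close> plus a Volterra term, so the map from \<open>P\<close> (with \<open>P(0) = 0\<close>) to its jump
  has a bounded inverse (\<open>char_jump_stability\<close>), and the \<open>P\<^sub>N\<close> themselves converge on \<open>[-2b, 2b]\<close> at
  the same rate. By a Bernstein inequality (\<open>bernstein_inequality_higher\<close>) each derivative costs a
  factor \<open>N\<close> away from the end points; along \<open>N = 2\<^sup>k\<close> this leaves a geometric series for all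
  derivatives up to order \<open>p + 1\<close>.

  Consequently, on every compact part of \<open>(-b, b)\<close>, the restrictions of \<open>\<A>\<close> and \<open>\<B>\<close> for
  \<open>P\<^sub>N\<close>, \<open>P\<^sub>N'\<close>, ..., up to the derivative of order \<open>p + 1\<close>, to the two characteristics converge
  uniformly. Their limits satisfy a finite system of ordinary differential equations with
  coefficient \<open>r\<close>, and \<open>q\<close> is a polynomial in \<open>r\<close> and these limits. Since \<open>r' = q - r\<^sup>2\<close>,
  smoothness of \<open>r\<close> passes to \<open>q\<close> and back to \<open>r\<close> with one derivative gained, until order \<open>p\<close> is
  reached (\<open>potential_regularity_bootstrap\<close>).
\<close>

section \<open>Bernstein's inequality away from the end points\<close>

text \<open>
  This is \<open>w\<^sup>n P(R (w + 1 / w) / 2)\<close>, expanded so that it is visibly a polynomial in \<open>w\<close>.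
  The Joukowski map \<open>w \<mapsto> (w + 1 / w) / 2\<close> takes the unit circle onto \<open>[-1, 1]\<close>.
\<close>
definition joukowski_transform :: "real \<Rightarrow> nat \<Rightarrow> complex poly \<Rightarrow> complex \<Rightarrow> complex" where
  "joukowski_transform R n p w =
     (\<Sum>k\<le>n. coeff p k * w ^ (n - k) * (of_real R * (w\<^sup>2 + 1) / 2) ^ k)"

lemma joukowski_transform_holomorphic: "joukowski_transform R n p holomorphic_on S"
  unfolding joukowski_transform_def by (intro holomorphic_intros) auto

text \<open>
  A bound on the interval is a bound on the unit circle, hence on the disc by the maximum
  principle. The transform is a self-reciprocal polynomial of degree \<open>2n\<close>, so that the substitution
  \<open>w \<mapsto> 1 / w\<close> carries the bound to the outside.
\<close>
lemma joukowski_transform_bound: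
  fixes p :: "complex poly" and R M :: real and n :: nat
  defines "Q \<equiv> joukowski_transform R n p"
  assumes deg: "degree p \<le> n" and R: "R > 0"
    and bound: "\<forall>x\<in>{-R..R}. norm (poly p (of_real x)) \<le> M"
  shows joukowski_transform_eq: "\<And>w. w \<noteq> 0 \<Longrightarrow> Q w = w ^ n * poly p (of_real R * (w + 1 / w) / 2)"
    and joukowski_transform_inside: "\<And>w. norm w \<le> 1 \<Longrightarrow> norm (Q w) \<le> M"
    and joukowski_transform_outside: "\<And>w. norm w \<ge> 1 \<Longrightarrow> norm (Q w) \<le> norm w ^ (2 * n) * M"
proof -
  show eq: "Q w = w ^ n * poly p (of_real R * (w + 1 / w) / 2)" if w: "w \<noteq> 0" for w
  proof -
    have "poly p z = (\<Sum>k\<le>n. coeff p k * z ^ k)" for z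
      unfolding poly_altdef using deg
      by (intro sum.mono_neutral_left) (auto simp: coeff_eq_0)
    then have "w ^ n * poly p (of_real R * (w + 1 / w) / 2)
        = (\<Sum>k\<le>n. w ^ n * (coeff p k * (of_real R * (w + 1 / w) / 2) ^ k))"
      by (simp add: sum_distrib_left)
    also have "\<dots> = Q w"
      unfolding Q_def joukowski_transform_def
    proof (intro sum.cong refl)
      fix k assume "k \<in> {..n}"
      then have "w ^ n = w ^ (n - k) * w ^ k"
        by (simp flip: power_add)
      moreover have "of_real R * (w\<^sup>2 + 1) / 2 = w * (of_real R * (w + 1 / w) / 2)"
        using w by (simp add: field_simps power2_eq_square)
      ultimately show "w ^ n * (coeff p k * (of_real R * (w + 1 / w) / 2) ^ k)
          = coeff p k * w ^ (n - k) * (of_real R * (w\<^sup>2 + 1) / 2) ^ k"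
        by (simp only: power_mult_distrib mult_ac)
    qed
    finally show ?thesis by simp
  qed
  have circle: "norm (Q w) \<le> M" if "norm w = 1" for w
  proof -
    have "w \<noteq> 0" using that by auto
    have "1 / w = cnj w"
      using that \<open>w \<noteq> 0\<close> by (simp add: field_simps complex_norm_square[symmetric])
    then have "of_real R * (w + 1 / w) / 2 = of_real (R * Re w)"
      by (simp add: complex_add_cnj)
    then have "Q w = w ^ n * poly p (of_real (R * Re w))"
      using eq[OF \<open>w \<noteq> 0\<close>] by (simp only:)
    moreover have "\<bar>Re w\<bar> \<le> 1" using abs_Re_le_cmod[of w] that by simp
    then have "\<bar>R * Re w\<bar> \<le> R"
      using R mult_left_mono[of "\<bar>Re w\<bar>" 1 R] by (simp add: abs_mult)
    then have "R * Re w \<in> {-R..R}" by auto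
    ultimately show ?thesis
      using bound that by (simp add: norm_mult norm_power del: of_real_mult)
  qed
  show inside: "norm (Q w) \<le> M" if "norm w \<le> 1" for w
  proof (rule maximum_modulus_frontier[of Q "cball 0 1"])
    show "Q holomorphic_on interior (cball 0 1)" "continuous_on (closure (cball 0 1)) Q"
      unfolding Q_def
      by (auto intro!: joukowski_transform_holomorphic holomorphic_on_imp_continuous_on)
  qed (use that circle in auto)
  show "norm (Q w) \<le> norm w ^ (2 * n) * M" if "norm w \<ge> 1" for w
  proof -
    have "w \<noteq> 0" using that by auto
    have "Q (1 / w) = (1 / w) ^ n * poly p (of_real R * (w + 1 / w) / 2)"
      using eq[of "1 / w"] \<open>w \<noteq> 0\<close> by (simp add: add.commute)
    then have "w ^ n * Q (1 / w) = poly p (of_real R * (w + 1 / w) / 2)"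
      using \<open>w \<noteq> 0\<close> by (simp add: power_divide)
    with eq[OF \<open>w \<noteq> 0\<close>] have "Q w = w ^ (2 * n) * Q (1 / w)"
      by (simp add: mult_2 power_add mult.assoc del: times_divide_eq_right)
    moreover have "norm (Q (1 / w)) \<le> M"
      using that by (intro inside) (simp add: norm_divide divide_le_eq_1)
    ultimately show ?thesis
      by (simp add: norm_mult norm_power mult_left_mono)
  qed
qed

text \<open>
  The transform grows by a factor of at most \<open>e\<close> on a circle of radius \<open>1 / (2n)\<close> about a point
  of the unit circle, so Cauchy's inequality bounds its derivative there by a multiple of \<open>n\<close>. The
  chain rule transfers this to \<open>P'\<close> except near the end points, where the Joukowski map is
  critical. The constant is not sharp, but the order \<open>n\<close> is what matters.
\<close>
lemma bernstein_inequality_interior: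
  fixes p :: "complex poly" and R \<rho> M :: real and n :: nat
  assumes deg: "degree p \<le> n" and rho: "\<rho> < R"
    and bound: "\<forall>x\<in>{-R..R}. norm (poly p (of_real x)) \<le> M"
    and x: "x \<in> {-\<rho>..\<rho>}"
  shows "norm (poly (pderiv p) (of_real x)) \<le> (1 + 2 * exp 1) / sqrt (R\<^sup>2 - \<rho>\<^sup>2) * real n * M"
proof (cases "n = 0")
  case True
  then have "pderiv p = 0" using deg by (simp add: pderiv_eq_0_iff)
  then show ?thesis using True by simp
next
  case False
  then have n: "n \<ge> 1" by simp
  have R: "R > 0" using rho x by auto
  have M: "M \<ge> 0" using R bound order_trans[OF norm_ge_zero] by fastforce
  define Q where "Q = joukowski_transform R n p"
  note Q = joukowski_transform_bound[OF deg R bound, folded Q_def]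
  define w where "w = Complex (x / R) (sqrt (1 - (x / R)\<^sup>2))"
  have xR: "\<bar>x\<bar> \<le> \<rho>" using x by auto
  have xr2: "x\<^sup>2 \<le> \<rho>\<^sup>2" using xR by (metis abs_le_square_iff abs_of_nonneg abs_ge_zero order_trans)
  have rr2: "\<rho>\<^sup>2 < R\<^sup>2" using xR rho by (intro power_strict_mono) auto
  have "(x / R)\<^sup>2 < 1" using xr2 rr2 R by (simp add: power_divide divide_less_eq_1)
  then have nw: "norm w = 1" by (simp add: w_def cmod_def)
  then have w0: "w \<noteq> 0" by auto
  have iw: "1 / w = cnj w"
    using nw w0 by (simp add: field_simps complex_norm_square[symmetric])
  have z: "of_real R * (w + 1 / w) / 2 = of_real x"
    unfolding iw complex_add_cnj using R by (simp add: w_def)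
  have holQ: "Q holomorphic_on S" for S
    unfolding Q_def by (rule joukowski_transform_holomorphic)
  have "norm ((deriv ^^ 1) Q w) \<le> fact 1 * (exp 1 * M) / (1 / (2 * real n)) ^ 1"
  proof (rule Cauchy_inequality)
    show "Q holomorphic_on ball w (1 / (2 * real n))" "continuous_on (cball w (1 / (2 * real n))) Q"
      using holQ holomorphic_on_imp_continuous_on by blast+
    show "0 < 1 / (2 * real n)" using n by simp
    fix v assume v: "norm (w - v) = 1 / (2 * real n)"
    show "norm (Q v) \<le> exp 1 * M"
    proof (cases "norm v \<le> 1")
      case True
      have "norm (Q v) \<le> 1 * M" using Q(2)[OF True] by simp
      also have "\<dots> \<le> exp 1 * M" using M by (intro mult_right_mono) auto
      finally show ?thesis .
    next
      case False
      have "norm v \<le> norm w + norm (w - v)" by (metis norm_triangle_sub norm_minus_commute)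
      also have "\<dots> \<le> exp (1 / (2 * real n))"
        using exp_ge_add_one_self[of "1 / (2 * real n)"] nw v by simp
      finally have "norm v ^ (2 * n) \<le> exp (1 / (2 * real n)) ^ (2 * n)"
        by (intro power_mono) auto
      also have "\<dots> = exp 1" using n by (simp flip: exp_of_nat_mult)
      finally have "norm v ^ (2 * n) * M \<le> exp 1 * M" using M by (rule mult_right_mono)
      then show ?thesis using Q(3)[of v] False by simp
    qed
  qed
  then have dQ: "norm (deriv Q w) \<le> 2 * exp 1 * real n * M" by (simp add: mult_ac)
  have "(Q has_field_derivative deriv Q w) (at w)"
    using holQ[of UNIV] by (simp add: holomorphic_derivI)
  moreover have "(Q has_field_derivative (of_nat n * w ^ (n - 1) * poly p (of_real x)
      + w ^ n * (poly (pderiv p) (of_real x) * (of_real R * (1 - 1 / w\<^sup>2) / 2)))) (at w)"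
  proof (rule has_field_derivative_transform_within_open)
    show "((\<lambda>w. w ^ n * poly p (of_real R * (w + 1 / w) / 2)) has_field_derivative
       (of_nat n * w ^ (n - 1) * poly p (of_real x)
      + w ^ n * (poly (pderiv p) (of_real x) * (of_real R * (1 - 1 / w\<^sup>2) / 2)))) (at w)"
      using w0 z
      by (auto intro!: derivative_eq_intros DERIV_chain2[OF poly_DERIV]
          simp: power2_eq_square field_simps)
    show "open (- {0::complex})" "w \<in> - {0}" using w0 by auto
  qed (use Q(1) in auto)
  ultimately have eq: "deriv Q w = of_nat n * w ^ (n - 1) * poly p (of_real x)
      + w ^ n * (poly (pderiv p) (of_real x) * (of_real R * (1 - 1 / w\<^sup>2) / 2))"
    by (rule DERIV_unique)
  \<comment> \<open>On the unit circle \<open>\<bar>1 - 1 / w\<^sup>2\<bar> = \<bar>w - 1 / w\<bar> = 2 \<bar>Im w\<bar>\<close>.\<close>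
  have "1 - 1 / w\<^sup>2 = (1 / w) * (w - 1 / w)"
    using w0 by (simp add: field_simps power2_eq_square)
  then have "norm (of_real R * (1 - 1 / w\<^sup>2) / 2) = R * \<bar>Im w\<bar>"
    unfolding iw complex_diff_cnj using nw R by (simp add: norm_mult)
  also have "\<dots> = sqrt (R\<^sup>2 * (1 - (x / R)\<^sup>2))"
    using R \<open>(x / R)\<^sup>2 < 1\<close> by (simp add: w_def real_sqrt_mult)
  also have "R\<^sup>2 * (1 - (x / R)\<^sup>2) = R\<^sup>2 - x\<^sup>2"
    using R by (simp add: field_simps)
  finally have nR: "norm (of_real R * (1 - 1 / w\<^sup>2) / 2) = sqrt (R\<^sup>2 - x\<^sup>2)" .
  have "sqrt (R\<^sup>2 - \<rho>\<^sup>2) * norm (poly (pderiv p) (of_real x))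
      \<le> sqrt (R\<^sup>2 - x\<^sup>2) * norm (poly (pderiv p) (of_real x))"
    using xr2 by (intro mult_right_mono) auto
  also have "\<dots> = norm (deriv Q w - of_nat n * w ^ (n - 1) * poly p (of_real x))"
    unfolding eq nR[symmetric] using nw by (simp add: norm_mult norm_power norm_divide)
  also have "\<dots> \<le> 2 * exp 1 * real n * M + real n * M"
  proof (rule order_trans[OF norm_triangle_ineq4 add_mono[OF dQ]])
    have "x \<in> {-R..R}" using x rho by auto
    then show "norm (of_nat n * w ^ (n - 1) * poly p (of_real x)) \<le> real n * M"
      using nw bound by (simp add: norm_mult norm_power mult_left_mono)
  qed
  finally show ?thesis using rr2 by (simp add: field_simps)
qed

lemma bernstein_inequality_higher:
  fixes R \<rho> :: real
  assumes "0 < \<rho>" and "\<rho> < R"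
  shows "\<exists>C\<ge>0. \<forall>p :: complex poly. \<forall>n M. degree p \<le> n \<longrightarrow>
    (\<forall>x\<in>{-R..R}. norm (poly p (of_real x)) \<le> M) \<longrightarrow>
    (\<forall>x\<in>{-\<rho>..\<rho>}. norm (poly ((pderiv ^^ i) p) (of_real x)) \<le> C * real n ^ i * M)"
  using assms
proof (induction i arbitrary: R)
  case 0
  then show ?case by (intro exI[of _ 1]) auto
next
  case (Suc i)
  \<comment> \<open>One derivative is taken on \<open>[-\<sigma>, \<sigma>]\<close>, the others on the remaining margin.\<close>
  define \<sigma> where "\<sigma> = (\<rho> + R) / 2"
  have \<sigma>: "\<rho> < \<sigma>" "\<sigma> < R" using Suc.prems by (auto simp: \<sigma>_def)
  define K where "K = (1 + 2 * exp 1) / sqrt (R\<^sup>2 - \<sigma>\<^sup>2)"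
  have "\<sigma>\<^sup>2 < R\<^sup>2" using \<sigma> Suc.prems by (intro power_strict_mono) auto
  then have K: "K \<ge> 0" by (simp add: K_def add_nonneg_nonneg)
  obtain C where C: "C \<ge> 0" and IH: "\<And>p :: complex poly. \<And>n M x. degree p \<le> n \<Longrightarrow>
      (\<forall>x\<in>{-\<sigma>..\<sigma>}. norm (poly p (of_real x)) \<le> M) \<Longrightarrow> x \<in> {-\<rho>..\<rho>} \<Longrightarrow>
      norm (poly ((pderiv ^^ i) p) (of_real x)) \<le> C * real n ^ i * M"
    using Suc.IH[OF Suc.prems(1) \<sigma>(1)] by metis
  show ?case
  proof (intro exI[of _ "C * K"] conjI allI impI ballI)
    show "C * K \<ge> 0" using C K by simp
    fix p :: "complex poly" and n M x
    assume p: "degree p \<le> n" "\<forall>x\<in>{-R..R}. norm (poly p (of_real x)) \<le> M"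
      and x: "x \<in> {-\<rho>..\<rho>}"
    have "norm (poly ((pderiv ^^ i) (pderiv p)) (of_real x)) \<le> C * real n ^ i * (K * real n * M)"
      using p \<sigma> x unfolding K_def
      by (intro IH ballI bernstein_inequality_interior) (auto simp: degree_pderiv)
    then show "norm (poly ((pderiv ^^ Suc i) p) (of_real x)) \<le> C * K * real n ^ Suc i * M"
      by (simp add: funpow_swap1 mult_ac)
  qed
qed

section \<open>Transmuted polynomials\<close>

text \<open>
  For \<open>\<eta>\<^sub>k(x) = x\<^sup>k\<close> this is \<open>(x + t)\<^sup>n\<close>. In general it is the image, under the
  transmutation \<open>x\<^sup>k \<mapsto> \<eta>\<^sub>k(x)\<close> in the variable \<open>x\<close>, of that polynomial.
\<close>
definition appell :: "(nat \<Rightarrow> real \<Rightarrow> complex) \<Rightarrow> nat \<Rightarrow> real \<Rightarrow> real \<Rightarrow> complex" where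
  "appell \<eta> n x t = (\<Sum>j\<le>n. of_nat (n choose j) * of_real t ^ j * \<eta> (n - j) x)"

definition transmute :: "(nat \<Rightarrow> real \<Rightarrow> complex) \<Rightarrow> complex poly \<Rightarrow> real \<Rightarrow> real \<Rightarrow> complex" where
  "transmute \<eta> P x t = (\<Sum>n\<le>degree P. coeff P n * appell \<eta> n x t)"

lemma transmute_eq_sum:
  assumes "degree P \<le> N"
  shows "transmute \<eta> P x t = (\<Sum>n\<le>N. coeff P n * appell \<eta> n x t)"
  unfolding transmute_def using assms
  by (intro sum.mono_neutral_left) (auto simp: coeff_eq_0)

lemma transmute_diff: "transmute \<eta> (P - Q) x t = transmute \<eta> P x t - transmute \<eta> Q x t"
proof -
  let ?N = "max (degree P) (degree Q)"
  have "degree (P - Q) \<le> ?N" by (rule degree_diff_le) auto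
  then show ?thesis
    by (simp add: transmute_eq_sum[of _ ?N] algebra_simps flip: sum_subtractf)
qed

text \<open>
  The \<open>t\<close>-derivative of an Appell sum of index \<open>n\<close> is \<open>n\<close> times the sum of index \<open>n - 1\<close>, so
  the right-hand side is the \<open>t\<close>-derivative of the transmuted polynomial.
\<close>
lemma transmute_pderiv:
  "transmute \<eta> (pderiv P) x t
    = (\<Sum>n\<le>degree P. coeff P n * (of_nat n * appell \<eta> (n - 1) x t))"
proof -
  have "transmute \<eta> (pderiv P) x t
      = (\<Sum>n\<le>degree P. coeff P (Suc n) * (of_nat (Suc n) * appell \<eta> n x t))"
    by (subst transmute_eq_sum[of _ "degree P"])
      (auto simp: degree_pderiv coeff_pderiv mult_ac intro!: sum.cong)
  also have "\<dots> = (\<Sum>n\<le>Suc (degree P). coeff P n * (of_nat n * appell \<eta> (n - 1) x t))"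
    by (subst sum.atMost_Suc_shift) simp
  also have "\<dots> = (\<Sum>n\<le>degree P. coeff P n * (of_nat n * appell \<eta> (n - 1) x t))"
    by (simp add: coeff_eq_0)
  finally show ?thesis .
qed

text \<open>
  Both the explicit \<open>t\<close>-dependence and the recursion of the family lower the index and
  produce the same sum of index \<open>n - 1\<close>. Hence the two contributions merge, and the slope
  \<open>\<sigma> = - \<kappa>\<close> is characteristic: along it the lower term disappears.
\<close>
lemma appell_derivative:
  fixes x \<sigma> c :: real
  assumes deriv: "\<And>k. (\<eta> k has_vector_derivative
        r * \<eta>' k x + \<kappa> * of_nat k * \<eta> (k - 1) x) (at x within S)"
  shows "((\<lambda>y. appell \<eta> n y (\<sigma> * y + c)) has_vector_derivative
      r * appell \<eta>' n x (\<sigma> * x + c)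
      + (of_real \<sigma> + \<kappa>) * of_nat n * appell \<eta> (n - 1) x (\<sigma> * x + c)) (at x within S)"
proof -
  define t :: complex where "t = of_real (\<sigma> * x + c)"
  have line: "((\<lambda>y. complex_of_real (\<sigma> * y + c)) has_vector_derivative of_real \<sigma>) (at x within S)"
    by (auto intro!: derivative_eq_intros)
  have pow: "((\<lambda>y. complex_of_real (\<sigma> * y + c) ^ j) has_vector_derivative
      of_nat j * t ^ (j - 1) * of_real \<sigma>) (at x within S)" for j
  proof (induction j)
    case (Suc j)
    show ?case
      using has_vector_derivative_mult[OF line Suc.IH]
      by (cases j) (auto simp: t_def algebra_simps)
  qed simp
  have shift1: "(\<Sum>j\<le>n. of_nat (n choose j) * (of_nat j * t ^ (j - 1) * \<eta> (n - j) x))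
      = of_nat n * (\<Sum>j\<le>n - 1. of_nat ((n - 1) choose j) * t ^ j * \<eta> (n - 1 - j) x)"
  proof (cases n)
    case (Suc m)
    have "(\<Sum>j\<le>n. of_nat (n choose j) * (of_nat j * t ^ (j - 1) * \<eta> (n - j) x))
        = (\<Sum>j\<le>m. of_nat (Suc j * (Suc m choose Suc j)) * t ^ j * \<eta> (m - j) x)"
      unfolding Suc by (subst sum.atMost_Suc_shift) (simp add: algebra_simps del: binomial_Suc_Suc)
    also have "\<dots> = (\<Sum>j\<le>m. of_nat (Suc m * (m choose j)) * t ^ j * \<eta> (m - j) x)"
      by (simp only: Suc_times_binomial)
    finally show ?thesis
      unfolding Suc by (simp only: sum_distrib_left of_nat_mult diff_Suc_1 mult.assoc)
  qed simp
  have shift2: "(\<Sum>j\<le>n. of_nat (n choose j) * t ^ j * (of_nat (n - j) * \<eta> (n - j - 1) x))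
      = of_nat n * (\<Sum>j\<le>n - 1. of_nat ((n - 1) choose j) * t ^ j * \<eta> (n - 1 - j) x)"
  proof (cases n)
    case (Suc m)
    have "(\<Sum>j\<le>n. of_nat (n choose j) * t ^ j * (of_nat (n - j) * \<eta> (n - j - 1) x))
        = (\<Sum>j\<le>m. of_nat ((n - j) * (n choose j)) * t ^ j * \<eta> (n - j - 1) x)"
      unfolding Suc by (simp add: mult_ac)
    also have "\<dots> = (\<Sum>j\<le>m. of_nat (n * ((n - 1) choose j)) * t ^ j * \<eta> (n - j - 1) x)"
      by (simp only: binomial_absorb_comp)
    also have "\<dots> = of_nat n * (\<Sum>j\<le>n - 1. of_nat ((n - 1) choose j) * t ^ j * \<eta> (n - 1 - j) x)"
      unfolding Suc by (simp add: sum_distrib_left mult.assoc del: of_nat_Suc mult_Suc)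
    finally show ?thesis .
  qed simp
  have "((\<lambda>y. appell \<eta> n y (\<sigma> * y + c)) has_vector_derivative
      (\<Sum>j\<le>n. of_nat (n choose j) * t ^ j *
          (r * \<eta>' (n - j) x + \<kappa> * of_nat (n - j) * \<eta> (n - j - 1) x)
        + of_nat (n choose j) * (of_nat j * t ^ (j - 1) * of_real \<sigma>) * \<eta> (n - j) x)) (at x within S)"
    unfolding appell_def t_def
    by (intro has_vector_derivative_sum has_vector_derivative_mult deriv
        has_vector_derivative_mult_right pow[unfolded t_def])
  also have "(\<Sum>j\<le>n. of_nat (n choose j) * t ^ j *
          (r * \<eta>' (n - j) x + \<kappa> * of_nat (n - j) * \<eta> (n - j - 1) x)
        + of_nat (n choose j) * (of_nat j * t ^ (j - 1) * of_real \<sigma>) * \<eta> (n - j) x)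
     = r * (\<Sum>j\<le>n. of_nat (n choose j) * t ^ j * \<eta>' (n - j) x)
      + \<kappa> * (\<Sum>j\<le>n. of_nat (n choose j) * t ^ j * (of_nat (n - j) * \<eta> (n - j - 1) x))
      + of_real \<sigma> * (\<Sum>j\<le>n. of_nat (n choose j) * (of_nat j * t ^ (j - 1) * \<eta> (n - j) x))"
    unfolding sum_distrib_left sum.distrib[symmetric] by (intro sum.cong) (auto simp: algebra_simps)
  also have "\<dots> = r * appell \<eta>' n x (\<sigma> * x + c)
      + (of_real \<sigma> + \<kappa>) * of_nat n * appell \<eta> (n - 1) x (\<sigma> * x + c)"
    unfolding shift1 shift2 by (simp add: appell_def t_def algebra_simps)
  finally show ?thesis .
qed

lemma transmute_derivative:
  fixes x \<sigma> c :: real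
  assumes deriv: "\<And>k. (\<eta> k has_vector_derivative
        r * \<eta>' k x + \<kappa> * of_nat k * \<eta> (k - 1) x) (at x within S)"
  shows "((\<lambda>y. transmute \<eta> P y (\<sigma> * y + c)) has_vector_derivative
      r * transmute \<eta>' P x (\<sigma> * x + c)
      + (of_real \<sigma> + \<kappa>) * transmute \<eta> (pderiv P) x (\<sigma> * x + c)) (at x within S)"
proof -
  have "((\<lambda>y. transmute \<eta> P y (\<sigma> * y + c)) has_vector_derivative
      (\<Sum>n\<le>degree P. coeff P n * (r * appell \<eta>' n x (\<sigma> * x + c)
      + (of_real \<sigma> + \<kappa>) * of_nat n * appell \<eta> (n - 1) x (\<sigma> * x + c)))) (at x within S)"
    unfolding transmute_def
    by (intro has_vector_derivative_sum has_vector_derivative_mult_right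
        appell_derivative[where r = r and \<eta>' = \<eta>'] deriv)
  then show ?thesis
    unfolding transmute_pderiv unfolding transmute_def
    by (simp add: sum_distrib_left sum.distrib algebra_simps)
qed

lemma transmute_at_zero:
  assumes "\<And>k. \<eta> k 0 = (if k = 0 then a else 0)"
  shows "transmute \<eta> P 0 t = a * poly P (of_real t)"
proof -
  have "appell \<eta> n 0 t = a * of_real t ^ n" for n
  proof -
    have "appell \<eta> n 0 t = (\<Sum>j\<le>n. if j = n then a * of_real t ^ n else 0)"
      unfolding appell_def using assms by (intro sum.cong) auto
    then show ?thesis by simp
  qed
  then show ?thesis
    by (simp add: transmute_def poly_altdef sum_distrib_left mult_ac)
qed

lemma transmute_continuous_on:
  assumes "\<And>k. continuous_on S (\<eta> k)"
  shows "continuous_on (S \<times> UNIV) (\<lambda>(x, t). transmute \<eta> P x t)"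
  unfolding transmute_def appell_def case_prod_beta
  by (intro continuous_intros continuous_on_compose2[OF assms]) auto

section \<open>Functions of class \<open>C\<^sup>k\<close> and uniform limits\<close>

lemma Ck_on_cong:
  assumes "open S" and "\<And>x. x \<in> S \<Longrightarrow> f x = g x" and "Ck_on k f S"
  shows "Ck_on k g S"
  using assms(2,3)
proof (induction k arbitrary: f g)
  case 0
  then show ?case using continuous_on_cong[of S S f g] by simp
next
  case (Suc k)
  have g: "(g has_vector_derivative vector_derivative f (at x)) (at x)" if "x \<in> S" for x
  proof (rule has_vector_derivative_transform_within_open)
    show "(f has_vector_derivative vector_derivative f (at x)) (at x)"
      using Suc.prems(2) that by (simp flip: vector_derivative_works)
  qed (use that \<open>open S\<close> Suc.prems(1) in simp_all)
  have "Ck_on k (\<lambda>x. vector_derivative g (at x)) S"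
  proof (rule Suc.IH)
    show "vector_derivative f (at x) = vector_derivative g (at x)" if "x \<in> S" for x
      using vector_derivative_at[OF g[OF that]] by simp
  qed (use Suc.prems in simp)
  then show ?case using g differentiableI_vector by fastforce
qed

lemma Ck_on_SucI:
  assumes "open S" and "\<And>x. x \<in> S \<Longrightarrow> (g has_vector_derivative g' x) (at x)" and "Ck_on k g' S"
  shows "Ck_on (Suc k) g S"
proof -
  have "Ck_on k (\<lambda>x. vector_derivative g (at x)) S"
    by (rule Ck_on_cong[OF assms(1) _ assms(3)]) (simp add: vector_derivative_at[OF assms(2)])
  then show ?thesis using assms(2) differentiableI_vector by fastforce
qed

lemma Ck_on_SucD: "Ck_on (Suc k) g S \<Longrightarrow> Ck_on k g S"
proof (induction k arbitrary: g)
  case 0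
  then show ?case
    by (auto intro!: continuous_at_imp_continuous_on differentiable_imp_continuous_within)
qed auto

lemma Ck_on_mono: "Ck_on k g S \<Longrightarrow> m \<le> k \<Longrightarrow> Ck_on m g S"
  by (induction k) (metis le_zero_eq, metis Ck_on_SucD le_SucE)

lemma Ck_on_has_vector_derivative:
  "Ck_on (Suc k) g S \<Longrightarrow> x \<in> S \<Longrightarrow> (g has_vector_derivative vector_derivative g (at x)) (at x)"
  by (simp add: vector_derivative_works)

lemma Ck_on_add:
  assumes "open S" "Ck_on k f S" "Ck_on k g S"
  shows "Ck_on k (\<lambda>x. f x + g x) S"
  using assms(2,3)
proof (induction k arbitrary: f g)
  case (Suc k)
  show ?case
    by (rule Ck_on_SucI[OF \<open>open S\<close> has_vector_derivative_add[OF
          Ck_on_has_vector_derivative[OF Suc.prems(1)] Ck_on_has_vector_derivative[OF Suc.prems(2)]]])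
      (use Suc in auto)
qed (simp add: continuous_on_add continuous_on_mult)

lemma Ck_on_mult:
  fixes f g :: "real \<Rightarrow> 'a :: real_normed_algebra"
  assumes "open S" "Ck_on k f S" "Ck_on k g S"
  shows "Ck_on k (\<lambda>x. f x * g x) S"
  using assms(2,3)
proof (induction k arbitrary: f g)
  case (Suc k)
  let ?f' = "\<lambda>x. vector_derivative f (at x)" and ?g' = "\<lambda>x. vector_derivative g (at x)"
  show ?case
  proof (rule Ck_on_SucI[OF \<open>open S\<close>])
    show "((\<lambda>x. f x * g x) has_vector_derivative f x * ?g' x + ?f' x * g x) (at x)" if "x \<in> S" for x
      using Suc.prems that by (intro has_vector_derivative_mult Ck_on_has_vector_derivative)
    have "Ck_on k f S" "Ck_on k g S" "Ck_on k ?f' S" "Ck_on k ?g' S"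
      using Suc.prems[THEN Ck_on_SucD] Suc.prems by auto
    then show "Ck_on k (\<lambda>x. f x * ?g' x + ?f' x * g x) S"
      by (intro Ck_on_add[OF \<open>open S\<close>] Suc.IH)
  qed
qed (simp add: continuous_on_add continuous_on_mult)

lemma Ck_on_const: "Ck_on k (\<lambda>x. c) S"
  by (induction k arbitrary: c) auto

lemma Ck_on_diff:
  fixes f g :: "real \<Rightarrow> 'a :: real_normed_algebra_1"
  assumes "open S" "Ck_on k f S" "Ck_on k g S"
  shows "Ck_on k (\<lambda>x. f x - g x) S"
proof -
  have "Ck_on k (\<lambda>x. f x + - 1 * g x) S"
    by (intro Ck_on_add Ck_on_mult Ck_on_const assms)
  then show ?thesis by (simp only: mult_minus1 diff_conv_add_uminus)
qed

text \<open>
  This reduces the regularity claim to the intervals \<open>(- c, c)\<close> with \<open>c < b\<close>, on which the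
  approximations converge uniformly.
\<close>
lemma Ck_on_locally:
  assumes "\<And>x. x \<in> S \<Longrightarrow> \<exists>T. open T \<and> x \<in> T \<and> Ck_on k g T"
  shows "Ck_on k g S"
  using assms
proof (induction k arbitrary: g)
  case 0
  have "isCont g x" if "x \<in> S" for x
    using 0[OF that] continuous_on_eq_continuous_at by auto
  then show ?case by (simp add: continuous_at_imp_continuous_on)
next
  case (Suc k)
  have "Ck_on k (\<lambda>x. vector_derivative g (at x)) S"
    using Suc.prems by (intro Suc.IH) fastforce
  then show ?case using Suc.prems by fastforce
qed

lemma uniform_limit_geometric:
  fixes F :: "nat \<Rightarrow> 'a \<Rightarrow> complex"
  assumes "\<And>k x. x \<in> S \<Longrightarrow> norm (F (Suc k) x - F k x) \<le> K * \<rho> ^ k" and "0 \<le> \<rho>" "\<rho> < 1"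
  shows "uniform_limit S F (\<lambda>x. lim (\<lambda>k. F k x)) sequentially"
proof -
  have "uniformly_convergent_on S (\<lambda>n x. \<Sum>k<n. F (Suc k) x - F k x)"
    using assms by (intro Weierstrass_m_test'[where M = "\<lambda>k. K * \<rho> ^ k"] summable_mult summable_geometric) auto
  then obtain l where "uniform_limit S (\<lambda>n x. \<Sum>k<n. F (Suc k) x - F k x) l sequentially"
    unfolding uniformly_convergent_on_def by blast
  then have "uniform_limit S (\<lambda>n x. F 0 x + (\<Sum>k<n. F (Suc k) x - F k x)) (\<lambda>x. F 0 x + l x) sequentially"
    by (intro uniform_limit_intros)
  moreover have "F 0 x + (\<Sum>k<n. F (Suc k) x - F k x) = F n x" for n x
    by (simp add: sum_lessThan_telescope[of "\<lambda>k. F k x"])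
  ultimately have "uniformly_convergent_on S F"
    unfolding uniformly_convergent_on_def by auto
  then show ?thesis by (simp add: uniformly_convergent_uniform_limit_iff)
qed

lemma uniform_limit_bounded_factor:
  fixes F :: "'i \<Rightarrow> 'a \<Rightarrow> complex"
  assumes "uniform_limit S F G L" and "\<And>x. x \<in> S \<Longrightarrow> norm (c x) \<le> K"
  shows "uniform_limit S (\<lambda>k x. c x * F k x) (\<lambda>x. c x * G x) L"
proof (rule uniform_limitI)
  fix e :: real assume e: "e > 0"
  define K' where "K' = \<bar>K\<bar> + 1"
  have "\<forall>\<^sub>F k in L. \<forall>x\<in>S. dist (F k x) (G x) < e / K'"
    using assms(1) e by (intro uniform_limitD) (auto simp: K'_def add_nonneg_pos)
  then show "\<forall>\<^sub>F k in L. \<forall>x\<in>S. dist (c x * F k x) (c x * G x) < e"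
  proof (rule eventually_mono, intro ballI)
    fix k x assume *: "\<forall>x\<in>S. dist (F k x) (G x) < e / K'" and x: "x \<in> S"
    have "dist (c x * F k x) (c x * G x) = norm (c x) * dist (F k x) (G x)"
      by (simp add: dist_norm norm_mult flip: right_diff_distrib)
    also have "\<dots> \<le> K' * dist (F k x) (G x)"
      using assms(2)[OF x] by (intro mult_right_mono) (auto simp: K'_def)
    also have "\<dots> < e" using * x by (auto simp: K'_def field_simps)
    finally show "dist (c x * F k x) (c x * G x) < e" .
  qed
qed

lemma has_vector_derivative_uniform_limit:
  fixes F F' :: "nat \<Rightarrow> real \<Rightarrow> complex"
  assumes S: "open S" "convex S"
    and deriv: "\<And>k x. x \<in> S \<Longrightarrow> (F k has_vector_derivative F' k x) (at x)"
    and lim': "uniform_limit S F' G' sequentially"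
    and lim: "\<And>x. x \<in> S \<Longrightarrow> (\<lambda>k. F k x) \<longlonglongrightarrow> G x"
    and x: "x \<in> S"
  shows "(G has_vector_derivative G' x) (at x)"
proof -
  have "\<exists>g. \<forall>x\<in>S. (\<lambda>k. F k x) \<longlonglongrightarrow> g x \<and> (g has_derivative (\<lambda>h. h *\<^sub>R G' x)) (at x within S)"
  proof (rule has_derivative_sequence[where f = F and f' = "\<lambda>k x h. h *\<^sub>R F' k x" and ?x0.0 = x])
    show "convex S" "x \<in> S" "(\<lambda>k. F k x) \<longlonglongrightarrow> G x" using S x lim by auto
    show "(F k has_derivative (\<lambda>h. h *\<^sub>R F' k x)) (at x within S)" if "x \<in> S" for k x
      using deriv[OF that] by (simp add: has_vector_derivative_def has_derivative_at_withinI)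
    fix e :: real assume "e > 0"
    with lim' have "\<forall>\<^sub>F k in sequentially. \<forall>x\<in>S. dist (F' k x) (G' x) < e"
      by (rule uniform_limitD)
    then show "\<forall>\<^sub>F k in sequentially. \<forall>x\<in>S. \<forall>h. norm (h *\<^sub>R F' k x - h *\<^sub>R G' x) \<le> e * norm h"
    proof (rule eventually_mono, intro ballI allI)
      fix k x h assume "\<forall>x\<in>S. dist (F' k x) (G' x) < e" "x \<in> S"
      then have "norm (F' k x - G' x) \<le> e" by (simp add: dist_norm less_imp_le)
      then show "norm (h *\<^sub>R F' k x - h *\<^sub>R G' x) \<le> e * norm h"
        using mult_left_mono[of "norm (F' k x - G' x)" e "\<bar>h\<bar>"]
        by (simp add: mult.commute flip: scaleR_diff_right)
    qed
  qed
  then obtain g where g: "\<And>x. x \<in> S \<Longrightarrow> (\<lambda>k. F k x) \<longlonglongrightarrow> g x"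
    "\<And>x. x \<in> S \<Longrightarrow> (g has_derivative (\<lambda>h. h *\<^sub>R G' x)) (at x within S)" by blast
  have eq: "g y = G y" if "y \<in> S" for y
    using LIMSEQ_unique[OF g(1)[OF that] lim[OF that]] .
  have "(g has_vector_derivative G' x) (at x)"
    using g(2)[OF x] unfolding has_vector_derivative_def at_within_open[OF x S(1)] .
  then show ?thesis
    using S(1) x eq by (rule has_vector_derivative_transform_within_open)
qed

section \<open>Regularity bootstrap along the characteristics\<close>

text \<open>
  The functions \<open>A\<^sub>i\<close>, \<open>B\<^sub>i\<close> and \<open>E\<^sub>i\<close>, \<open>H\<^sub>i\<close> stand for the values of the two components on the
  characteristics \<open>t = x\<close> and \<open>t = - x\<close>, belonging to the \<open>i\<close>-th derivative of the Cauchy data.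
  By their differential equations, smoothness of order \<open>m\<close> for index \<open>i\<close> requires only order
  \<open>m - 1\<close> of \<open>r\<close> and the indices up to \<open>i + m\<close>. The formula for \<open>q\<close> involves \<open>r\<close> and the indices
  \<open>0\<close> and \<open>1\<close>, so \<open>q\<close> is as smooth as \<open>r\<close> up to order \<open>p\<close>, while the Riccati equation makes \<open>r\<close>
  one order smoother than \<open>q\<close>.
\<close>
lemma potential_regularity_bootstrap:
  fixes r q :: "real \<Rightarrow> complex" and A B E H :: "nat \<Rightarrow> real \<Rightarrow> complex"
  assumes S: "open S"
    and r: "\<And>x. x \<in> S \<Longrightarrow> (r has_vector_derivative q x - r x * r x) (at x)"
    and cont: "\<And>i. i \<le> Suc p \<Longrightarrow> continuous_on S (A i) \<and> continuous_on S (B i) \<and>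
        continuous_on S (E i) \<and> continuous_on S (H i)"
    and A: "\<And>i x. i \<le> p \<Longrightarrow> x \<in> S \<Longrightarrow>
        (A i has_vector_derivative r x * B i x + 2 * A (Suc i) x) (at x)"
    and B: "\<And>i x. i \<le> p \<Longrightarrow> x \<in> S \<Longrightarrow> (B i has_vector_derivative r x * A i x) (at x)"
    and E: "\<And>i x. i \<le> p \<Longrightarrow> x \<in> S \<Longrightarrow> (E i has_vector_derivative r x * H i x) (at x)"
    and H: "\<And>i x. i \<le> p \<Longrightarrow> x \<in> S \<Longrightarrow>
        (H i has_vector_derivative r x * E i x - 2 * H (Suc i) x) (at x)"
    and q: "\<And>x. x \<in> S \<Longrightarrow>
        ((\<lambda>x. A 0 x + B 0 x - E 0 x - H 0 x) has_vector_derivative q x / 2) (at x)"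
  shows "Ck_on p q S"
proof -
  have traces: "Ck_on m (A i) S \<and> Ck_on m (B i) S \<and> Ck_on m (E i) S \<and> Ck_on m (H i) S"
    if "Ck_on k r S" "m \<le> Suc k" "i + m \<le> Suc p" for k m i
    using that(2,3)
  proof (induction m arbitrary: i)
    case 0
    then show ?case using cont by auto
  next
    case (Suc m)
    have i: "i \<le> p" using Suc.prems by simp
    have rm: "Ck_on m r S" using Ck_on_mono[OF that(1)] Suc.prems by simp
    have IH: "Ck_on m (A i) S" "Ck_on m (B i) S" "Ck_on m (E i) S" "Ck_on m (H i) S"
      "Ck_on m (A (Suc i)) S" "Ck_on m (H (Suc i)) S"
      using Suc.IH[of i] Suc.IH[of "Suc i"] Suc.prems by auto
    show ?case
      by (intro conjI Ck_on_SucI[OF S A[OF i]] Ck_on_SucI[OF S B[OF i]]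
          Ck_on_SucI[OF S E[OF i]] Ck_on_SucI[OF S H[OF i]]
          Ck_on_add Ck_on_diff Ck_on_mult Ck_on_const S rm IH)
  qed
  have q_eq: "2 * ((r x * B 0 x + 2 * A 1 x) + r x * A 0 x - r x * H 0 x - (r x * E 0 x - 2 * H 1 x)) = q x"
    if "x \<in> S" for x
  proof -
    have D: "((\<lambda>x. A 0 x + B 0 x - E 0 x - H 0 x) has_vector_derivative
        (r x * B 0 x + 2 * A 1 x) + r x * A 0 x - r x * H 0 x - (r x * E 0 x - 2 * H 1 x)) (at x)"
      using A[of 0 x] B[of 0 x] E[of 0 x] H[of 0 x] that
      by (intro has_vector_derivative_add has_vector_derivative_diff) auto
    show ?thesis unfolding vector_derivative_unique_at[OF D q[OF that]] by simp
  qed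
  have step: "Ck_on k q S" if "Ck_on k r S" "k \<le> p" for k
  proof (rule Ck_on_cong[OF S q_eq])
    have "Ck_on k (A 0) S" "Ck_on k (B 0) S" "Ck_on k (E 0) S" "Ck_on k (H 0) S"
      "Ck_on k (A 1) S" "Ck_on k (H 1) S"
      using traces[OF that(1), of k 0] traces[OF that(1), of k 1] that(2) by auto
    then show "Ck_on k (\<lambda>x. 2 * ((r x * B 0 x + 2 * A 1 x) + r x * A 0 x - r x * H 0 x
        - (r x * E 0 x - 2 * H 1 x))) S"
      using that(1) by (intro Ck_on_add Ck_on_diff Ck_on_mult Ck_on_const S)
  qed
  have "Ck_on k r S" if "k \<le> p" for k
    using that
  proof (induction k)
    case 0
    have "isCont r x" if "x \<in> S" for x
      using r[OF that] by (rule has_vector_derivative_continuous)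
    then show ?case by (simp add: continuous_at_imp_continuous_on)
  next
    case (Suc k)
    then have "Ck_on k r S" "Ck_on k q S" using step by auto
    then show ?case by (intro Ck_on_SucI[OF S r] Ck_on_diff Ck_on_mult S)
  qed
  then show ?thesis using step by simp
qed

section \<open>The first-order wave system\<close>

text \<open>
  The mean value inequality with a majorant that depends only on the distance from the origin,
  which treats both signs of \<open>x\<close> at once.
\<close>
lemma norm_diff_le_growth:
  fixes F :: "real \<Rightarrow> complex"
  assumes x: "x \<in> {-b..b}"
    and F: "\<And>y. y \<in> closed_segment 0 x \<Longrightarrow> (F has_vector_derivative F' y) (at y within {-b..b})"
    and F': "\<And>y. y \<in> closed_segment 0 x \<Longrightarrow> norm (F' y) \<le> \<phi>' \<bar>y\<bar>"
    and phi: "\<And>s. (\<phi> has_real_derivative \<phi>' s) (at s)"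
  shows "norm (F x - F 0) \<le> \<phi> \<bar>x\<bar> - \<phi> 0"
proof (cases "x = 0")
  case False
  define \<tau> where "\<tau> = sgn x"
  have x\<tau>: "x = \<tau> * \<bar>x\<bar>" and \<tau>: "\<bar>\<tau>\<bar> = 1" using False by (auto simp: \<tau>_def sgn_if)
  have seg: "\<tau> * s \<in> closed_segment 0 x" and inb: "\<tau> * s \<in> {-b..b}" if "s \<in> {0..\<bar>x\<bar>}" for s
    using that x by (auto simp: \<tau>_def sgn_if closed_segment_eq_real_ivl split: if_splits)
  have deriv: "((\<lambda>s. F (\<tau> * s)) has_vector_derivative \<tau> *\<^sub>R F' (\<tau> * s)) (at s within {0..\<bar>x\<bar>})"
    if "s \<in> {0..\<bar>x\<bar>}" for s
  proof -
    have "((\<lambda>s. \<tau> * s) has_vector_derivative \<tau>) (at s within {0..\<bar>x\<bar>})"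
      by (auto intro!: derivative_eq_intros)
    moreover have "(F has_vector_derivative F' (\<tau> * s)) (at (\<tau> * s) within (\<lambda>s. \<tau> * s) ` {0..\<bar>x\<bar>})"
      using F[OF seg[OF that]] inb by (auto intro: has_vector_derivative_within_subset)
    ultimately show ?thesis
      using vector_diff_chain_within[of "\<lambda>s. \<tau> * s" \<tau> s "{0..\<bar>x\<bar>}" F] by (simp add: o_def)
  qed
  have "norm (F (\<tau> * \<bar>x\<bar>) - F (\<tau> * 0)) \<le> \<phi> \<bar>x\<bar> - \<phi> 0"
  proof (rule differentiable_bound_general[where f = "\<lambda>s. F (\<tau> * s)" and \<phi> = \<phi>])
    show "continuous_on {0..\<bar>x\<bar>} (\<lambda>s. F (\<tau> * s))"
      using deriv by (rule continuous_on_vector_derivative)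
    show "continuous_on {0..\<bar>x\<bar>} \<phi>"
      using phi by (intro continuous_at_imp_continuous_on ballI DERIV_isCont)
    fix s assume s: "0 < s" "s < \<bar>x\<bar>"
    show "((\<lambda>s. F (\<tau> * s)) has_vector_derivative \<tau> *\<^sub>R F' (\<tau> * s)) (at s)"
      using deriv[of s] s at_within_interior[of s "{0..\<bar>x\<bar>}"] by simp
    show "(\<phi> has_vector_derivative \<phi>' s) (at s)"
      using phi by (simp flip: has_real_derivative_iff_has_vector_derivative)
    show "norm (\<tau> *\<^sub>R F' (\<tau> * s)) \<le> \<phi>' s"
      using F'[OF seg, of s] s \<tau> by (simp add: abs_mult)
  qed (use False in auto)
  then show ?thesis using x\<tau> by simp
qed simp

text \<open>
  In the application \<open>al\<close> and \<open>be\<close> are the half sum and the half difference of \<open>\<phi>\<^sub>k\<close> and \<open>\<psi>\<^sub>k\<close>, which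
  diagonalizes the principal part: \<open>al\<close> is transported along \<open>x + t = const\<close> and \<open>be\<close> along
  \<open>x - t = const\<close>, with coupling \<open>r\<close>.
\<close>
locale wave_system =
  fixes b R :: real and r :: "real \<Rightarrow> complex" and al be :: "nat \<Rightarrow> real \<Rightarrow> complex"
  assumes b_pos: "b > 0" and R_pos: "R > 0"
    and r_bound: "x \<in> {-b..b} \<Longrightarrow> norm (r x) \<le> R"
    and al_deriv: "x \<in> {-b..b} \<Longrightarrow>
      (al k has_vector_derivative r x * be k x + of_nat k * al (k - 1) x) (at x within {-b..b})"
    and be_deriv: "x \<in> {-b..b} \<Longrightarrow>
      (be k has_vector_derivative r x * al k x - of_nat k * be (k - 1) x) (at x within {-b..b})"
    and al_zero: "al k 0 = (if k = 0 then 1 else 0)"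
    and be_zero: "be k 0 = 0"
begin

abbreviation "\<A> \<equiv> transmute al"
abbreviation "\<B> \<equiv> transmute be"

text \<open>
  For \<open>r = 0\<close> this is \<open>P(2x) - P(0)\<close>. In the application it is twice the linear combination of
  the functions \<open>s\<^sub>n\<close> whose coefficients are those of \<open>P\<close>.
\<close>
definition char_jump :: "complex poly \<Rightarrow> real \<Rightarrow> complex" where
  "char_jump P x = \<A> P x x + \<B> P x x - \<A> P x (- x) - \<B> P x (- x)"

lemma A_zero: "\<A> P 0 t = poly P (of_real t)"
  by (subst transmute_at_zero[where a = 1]) (auto simp: al_zero)

lemma B_zero: "\<B> P 0 t = 0"
  by (subst transmute_at_zero[where a = 0]) (auto simp: be_zero)

lemma A_line:
  assumes "x \<in> {-b..b}"
  shows "((\<lambda>y. \<A> P y (\<sigma> * y + c)) has_vector_derivative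
      r x * \<B> P x (\<sigma> * x + c) + (of_real \<sigma> + 1) * \<A> (pderiv P) x (\<sigma> * x + c)) (at x within {-b..b})"
  by (rule transmute_derivative) (use al_deriv[OF assms] in simp)

lemma B_line:
  assumes "x \<in> {-b..b}"
  shows "((\<lambda>y. \<B> P y (\<sigma> * y + c)) has_vector_derivative
      r x * \<A> P x (\<sigma> * x + c) + (of_real \<sigma> - 1) * \<B> (pderiv P) x (\<sigma> * x + c)) (at x within {-b..b})"
  using transmute_derivative[where \<eta> = be and \<eta>' = al and r = "r x" and \<kappa> = "-1" and \<sigma> = \<sigma> and c = c
    and P = P and x = x and S = "{-b..b}"] be_deriv[OF assms] by simp

lemma AB_continuous:
  "continuous_on ({-b..b} \<times> UNIV) (\<lambda>(x, t). \<A> P x t)"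
  "continuous_on ({-b..b} \<times> UNIV) (\<lambda>(x, t). \<B> P x t)"
  by (rule transmute_continuous_on, rule continuous_on_vector_derivative,
      erule al_deriv be_deriv)+

text \<open>
  Both characteristics through a point of the diamond \<open>\<bar>x\<bar> + \<bar>t\<bar> \<le> s\<close> stay inside the diamond on
  their way to the axis \<open>x = 0\<close>. In the supremum norm with weight \<open>exp (- 2 R \<bar>x\<bar>)\<close> the coupling
  has norm at most one half, so it can be absorbed.
\<close>
lemma wave_bound:
  assumes m: "\<And>\<tau>. \<bar>\<tau>\<bar> \<le> s \<Longrightarrow> norm (poly P (of_real \<tau>)) \<le> m"
    and x: "x \<in> {-b..b}" and xt: "\<bar>x\<bar> + \<bar>t\<bar> \<le> s"
  shows "norm (\<A> P x t) \<le> 2 * m * exp (2 * R * \<bar>x\<bar>)" "norm (\<B> P x t) \<le> 2 * m * exp (2 * R * \<bar>x\<bar>)"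
proof -
  define W where "W = {-b..b} \<times> {-s..s} \<inter> {z. \<bar>fst z\<bar> + \<bar>snd z\<bar> \<le> s}"
  define w where "w = (\<lambda>z. exp (- (2 * R * \<bar>fst z\<bar>)) *
    max (norm (\<A> P (fst z) (snd z))) (norm (\<B> P (fst z) (snd z))))"
  have W: "(y, u) \<in> W \<longleftrightarrow> y \<in> {-b..b} \<and> \<bar>y\<bar> + \<bar>u\<bar> \<le> s" for y u
    by (auto simp: W_def)
  have "closed {z :: real \<times> real. \<bar>fst z\<bar> + \<bar>snd z\<bar> \<le> s}"
    by (intro closed_Collect_le continuous_intros)
  then have "compact W"
    unfolding W_def by (intro compact_Int_closed compact_Times) auto
  moreover have "continuous_on W w"
    unfolding w_def using AB_continuous[of P, THEN continuous_on_subset, of W]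
    by (intro continuous_intros) (auto simp: W_def case_prod_beta)
  ultimately have "bdd_above (w ` W)"
    by (intro bounded_imp_bdd_above compact_imp_bounded compact_continuous_image)
  define N where "N = Sup (w ` W)"
  have le_N: "w z \<le> N" if "z \<in> W" for z
    unfolding N_def using that \<open>bdd_above (w ` W)\<close> by (rule cSUP_upper)
  have bound_N: "norm (\<A> P y u) \<le> N * exp (2 * R * \<bar>y\<bar>)" "norm (\<B> P y u) \<le> N * exp (2 * R * \<bar>y\<bar>)"
    if "(y, u) \<in> W" for y u
    using le_N[OF that] by (simp_all add: w_def exp_minus field_simps max_def split: if_splits)
  have m0: "m \<ge> 0" using order_trans[OF norm_ge_zero m[of 0]] xt by simp
  have N0: "N \<ge> 0" using order_trans[OF norm_ge_zero bound_N(1)[of x t]] x xt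
    by (simp add: W zero_le_mult_iff)
  have step: "w (y, u) \<le> m + N / 2" if "(y, u) \<in> W" for y u
  proof -
    have y: "y \<in> {-b..b}" and yu: "\<bar>y\<bar> + \<bar>u\<bar> \<le> s" using that by (auto simp: W)
    have inb: "z \<in> {-b..b}" if "z \<in> closed_segment 0 y" for z
      using that y by (auto simp: closed_segment_eq_real_ivl split: if_splits)
    have phi: "((\<lambda>v. N / 2 * exp (2 * R * v)) has_real_derivative R * (N * exp (2 * R * v))) (at v)" for v
      by (auto intro!: derivative_eq_intros)
    have "norm (\<A> P y (- 1 * y + (y + u)) - \<A> P 0 (- 1 * 0 + (y + u)))
        \<le> N / 2 * exp (2 * R * \<bar>y\<bar>) - N / 2 * exp (2 * R * 0)"
    proof (rule norm_diff_le_growth[OF y A_line[OF inb] _ phi])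
      fix z assume z: "z \<in> closed_segment 0 y"
      then have "(z, - 1 * z + (y + u)) \<in> W"
        using inb[OF z] yu by (auto simp: W closed_segment_eq_real_ivl abs_if split: if_splits)
      then show "norm (r z * \<B> P z (- 1 * z + (y + u))
          + (of_real (- 1) + 1) * \<A> (pderiv P) z (- 1 * z + (y + u))) \<le> R * (N * exp (2 * R * \<bar>z\<bar>))"
        using bound_N(2) r_bound[OF inb[OF z]] R_pos by (auto simp: norm_mult intro!: mult_mono)
    qed
    moreover have "norm (\<A> P 0 (y + u)) \<le> m"
      using yu unfolding A_zero by (intro m) auto
    ultimately have A: "norm (\<A> P y u) \<le> m + N / 2 * exp (2 * R * \<bar>y\<bar>)"
      using N0 norm_triangle_sub[of "\<A> P y u" "\<A> P 0 (y + u)"] by simp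
    have "norm (\<B> P y (1 * y + (u - y)) - \<B> P 0 (1 * 0 + (u - y)))
        \<le> N / 2 * exp (2 * R * \<bar>y\<bar>) - N / 2 * exp (2 * R * 0)"
    proof (rule norm_diff_le_growth[OF y B_line[OF inb] _ phi])
      fix z assume z: "z \<in> closed_segment 0 y"
      then have "(z, 1 * z + (u - y)) \<in> W"
        using inb[OF z] yu by (auto simp: W closed_segment_eq_real_ivl abs_if split: if_splits)
      then show "norm (r z * \<A> P z (1 * z + (u - y))
          + (of_real 1 - 1) * \<B> (pderiv P) z (1 * z + (u - y))) \<le> R * (N * exp (2 * R * \<bar>z\<bar>))"
        using bound_N(1) r_bound[OF inb[OF z]] R_pos by (auto simp: norm_mult intro!: mult_mono)
    qed
    then have B: "norm (\<B> P y u) \<le> m + N / 2 * exp (2 * R * \<bar>y\<bar>)"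
      using N0 m0 by (simp add: B_zero)
    have "1 \<le> exp (2 * R * \<bar>y\<bar>)" using R_pos by simp
    then have "m \<le> m * exp (2 * R * \<bar>y\<bar>)" using m0 by (simp add: mult_le_cancel_left1)
    with A B have "max (norm (\<A> P y u)) (norm (\<B> P y u)) \<le> (m + N / 2) * exp (2 * R * \<bar>y\<bar>)"
      by (simp add: algebra_simps)
    then show ?thesis by (simp add: w_def exp_minus field_simps)
  qed
  have xtW: "(x, t) \<in> W" using x xt by (simp add: W)
  then have "N \<le> m + N / 2"
    unfolding N_def using step by (intro cSUP_least) (auto simp: N_def)
  then have "N \<le> 2 * m" by simp
  then have "N * exp (2 * R * \<bar>x\<bar>) \<le> 2 * m * exp (2 * R * \<bar>x\<bar>)" by (intro mult_right_mono) auto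
  then show "norm (\<A> P x t) \<le> 2 * m * exp (2 * R * \<bar>x\<bar>)" "norm (\<B> P x t) \<le> 2 * m * exp (2 * R * \<bar>x\<bar>)"
    using bound_N[OF xtW] by linarith+
qed

text \<open>
  A Volterra argument in the weighted norm \<open>N = sup \<bar>P(\<tau>)\<bar> exp (- \<mu> \<bar>\<tau>\<bar>)\<close>. By \<open>wave_bound\<close>,
  applied to each diamond separately, the weight carries over to \<open>\<A>\<close> and \<open>\<B>\<close>. Along
  the characteristics through the origin the diamonds grow, and integration gains a factor
  \<open>1 / \<mu>\<close>. Along those that join \<open>(x, \<plusminus>x)\<close> to \<open>(0, \<plusminus>2x)\<close> all points have the same diamond;
  there the integrand itself is first estimated by integrating along the transversal
  characteristics, which gains the factor. For large \<open>\<mu>\<close> the jump therefore differs from \<open>P(2x)\<close>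
  by at most half of the weighted norm.
\<close>
lemma char_jump_stability:
  obtains C where "C \<ge> 0" and "\<And>P \<epsilon> \<tau>. poly P 0 = 0 \<Longrightarrow>
    (\<And>x. x \<in> {-b..b} \<Longrightarrow> norm (char_jump P x) \<le> \<epsilon>) \<Longrightarrow> \<tau> \<in> {-2*b..2*b} \<Longrightarrow>
    norm (poly P (of_real \<tau>)) \<le> C * \<epsilon>"
proof
  define C where "C = 2 * exp (2 * R * b)"
  \<comment> \<open>\<open>\<mu>\<close> is chosen such that the bounds of the Volterra terms add up to \<open>N / 2\<close> times the weight
      \<open>exp (2 \<mu> \<bar>x\<bar>)\<close>.\<close>
  define \<mu> where "\<mu> = 2 * (R * C * (1 + b * R) + R / 2)"
  have C: "C > 0" by (simp add: C_def)
  have l: "\<mu> > 0" using R_pos b_pos C by (simp add: \<mu>_def add_pos_pos)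
  show "2 * exp (2 * \<mu> * b) \<ge> 0" by simp
  fix P \<epsilon> \<tau>
  assume P0: "poly P 0 = 0" and jump: "\<And>x. x \<in> {-b..b} \<Longrightarrow> norm (char_jump P x) \<le> \<epsilon>"
    and \<tau>: "\<tau> \<in> {-2*b..2*b}"
  define w where "w = (\<lambda>\<tau>. exp (- (\<mu> * \<bar>\<tau>\<bar>)) * norm (poly P (of_real \<tau>)))"
  have "continuous_on {-2*b..2*b} w"
    unfolding w_def by (intro continuous_intros)
  then have bdd: "bdd_above (w ` {-2*b..2*b})"
    by (intro bounded_imp_bdd_above compact_imp_bounded compact_continuous_image) auto
  define N where "N = Sup (w ` {-2*b..2*b})"
  have bound_N: "norm (poly P (of_real \<tau>)) \<le> N * exp (\<mu> * \<bar>\<tau>\<bar>)" if "\<bar>\<tau>\<bar> \<le> 2 * b" for \<tau>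
  proof -
    have "w \<tau> \<le> N"
      unfolding N_def using that bdd by (intro cSUP_upper) auto
    then show ?thesis by (simp add: w_def exp_minus field_simps)
  qed
  have N0: "N \<ge> 0" using order_trans[OF norm_ge_zero bound_N[of 0]] b_pos by simp
  have diamond: "norm (\<A> P x t) \<le> C * N * exp (\<mu> * (\<bar>x\<bar> + \<bar>t\<bar>))"
    "norm (\<B> P x t) \<le> C * N * exp (\<mu> * (\<bar>x\<bar> + \<bar>t\<bar>))"
    if "x \<in> {-b..b}" "\<bar>x\<bar> + \<bar>t\<bar> \<le> 2 * b" for x t
  proof -
    have "norm (poly P (of_real \<tau>)) \<le> N * exp (\<mu> * (\<bar>x\<bar> + \<bar>t\<bar>))" if "\<bar>\<tau>\<bar> \<le> \<bar>x\<bar> + \<bar>t\<bar>" for \<tau>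
      using that \<open>\<bar>x\<bar> + \<bar>t\<bar> \<le> 2 * b\<close> l N0
      by (intro order_trans[OF bound_N] mult_left_mono) auto
    then have "norm (\<A> P x t) \<le> 2 * (N * exp (\<mu> * (\<bar>x\<bar> + \<bar>t\<bar>))) * exp (2 * R * \<bar>x\<bar>)"
      "norm (\<B> P x t) \<le> 2 * (N * exp (\<mu> * (\<bar>x\<bar> + \<bar>t\<bar>))) * exp (2 * R * \<bar>x\<bar>)"
      using wave_bound[where s = "\<bar>x\<bar> + \<bar>t\<bar>" and t = t] \<open>x \<in> {-b..b}\<close> by blast+
    moreover have "2 * (N * exp (\<mu> * (\<bar>x\<bar> + \<bar>t\<bar>))) * exp (2 * R * \<bar>x\<bar>)
        \<le> 2 * (N * exp (\<mu> * (\<bar>x\<bar> + \<bar>t\<bar>))) * exp (2 * R * b)"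
      using that N0 R_pos by (intro mult_left_mono) auto
    ultimately show "norm (\<A> P x t) \<le> C * N * exp (\<mu> * (\<bar>x\<bar> + \<bar>t\<bar>))"
      "norm (\<B> P x t) \<le> C * N * exp (\<mu> * (\<bar>x\<bar> + \<bar>t\<bar>))"
      unfolding C_def by (auto simp: mult_ac)
  qed
  define D where "D = R * C * N / (2 * \<mu>)"
  have D0: "D \<ge> 0" using R_pos C N0 l by (simp add: D_def)
  have step: "norm (poly P (of_real (2 * x))) \<le> (\<epsilon> + N / 2) * exp (\<mu> * (2 * \<bar>x\<bar>))"
    if x: "x \<in> {-b..b}" for x
  proof -
    have inb: "y \<in> {-b..b}" if "y \<in> closed_segment 0 x" for y
      using that x by (auto simp: closed_segment_eq_real_ivl split: if_splits)
    have sub: "z \<in> closed_segment 0 x" if "y \<in> closed_segment 0 x" "z \<in> closed_segment 0 y" for y z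
      using that by (auto simp: closed_segment_eq_real_ivl split: if_splits)
    have x_le: "2 * \<bar>x\<bar> \<le> 2 * b" using x by auto
    have phi: "((\<lambda>s. D * exp (\<mu> * (2 * k)) * exp (\<mu> * (2 * s))) has_real_derivative
        R * (C * N * exp (\<mu> * (2 * k + 2 * s)))) (at s)" for k s
      using l by (auto intro!: derivative_eq_intros simp: D_def exp_add distrib_left)
    have rA: "norm (r y * v + (of_real 1 - 1) * v') \<le> R * K"
      and rB: "norm (r y * v + (of_real (- 1) + 1) * v') \<le> R * K"
      if "y \<in> closed_segment 0 x" "norm v \<le> K" for y v v' K
      using r_bound[OF inb[OF that(1)]] that(2) R_pos by (auto simp: norm_mult intro!: mult_mono)
    have diag: "\<bar>y\<bar> + \<bar>y\<bar> \<le> 2 * b" "\<bar>y\<bar> \<le> \<bar>x\<bar>" if "y \<in> closed_segment 0 x" for y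
      using inb[OF that] that by (auto simp: closed_segment_eq_real_ivl split: if_splits)
    have E: "exp (\<mu> * (2 * (\<bar>x\<bar> - \<bar>y\<bar>))) * exp (\<mu> * (2 * \<bar>y\<bar>)) = exp (\<mu> * (2 * \<bar>x\<bar>))" for y
      by (simp flip: exp_add add: algebra_simps)
    \<comment> \<open>The characteristics that end at the origin: \<open>D\<close> contains the gain \<open>1 / (2 \<mu>)\<close> from
        integrating the weight.\<close>
    have "norm (\<B> P x (1 * x + 0) - \<B> P 0 (1 * 0 + 0))
        \<le> D * exp (\<mu> * (2 * 0)) * exp (\<mu> * (2 * \<bar>x\<bar>)) - D * exp (\<mu> * (2 * 0)) * exp (\<mu> * (2 * 0))"
    proof (rule norm_diff_le_growth[OF x B_line[OF inb] rA phi])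
      fix z assume z: "z \<in> closed_segment 0 x"
      show "norm (\<A> P z (1 * z + 0)) \<le> C * N * exp (\<mu> * (2 * 0 + 2 * \<bar>z\<bar>))"
        using diamond(1)[OF inb[OF z], of "1 * z + 0"] diag[OF z] by (simp flip: mult_2)
    qed
    then have 1: "norm (\<B> P x x) \<le> D * exp (\<mu> * (2 * \<bar>x\<bar>))"
      using D0 by (simp add: B_zero)
    have "norm (\<A> P x (- 1 * x + 0) - \<A> P 0 (- 1 * 0 + 0))
        \<le> D * exp (\<mu> * (2 * 0)) * exp (\<mu> * (2 * \<bar>x\<bar>)) - D * exp (\<mu> * (2 * 0)) * exp (\<mu> * (2 * 0))"
    proof (rule norm_diff_le_growth[OF x A_line[OF inb] rB phi])
      fix z assume z: "z \<in> closed_segment 0 x"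
      show "norm (\<B> P z (- 1 * z + 0)) \<le> C * N * exp (\<mu> * (2 * 0 + 2 * \<bar>z\<bar>))"
        using diamond(2)[OF inb[OF z], of "- 1 * z + 0"] diag[OF z] by (simp flip: mult_2)
    qed
    then have 2: "norm (\<A> P x (- x)) \<le> D * exp (\<mu> * (2 * \<bar>x\<bar>))"
      using D0 by (simp add: A_zero P0)
    \<comment> \<open>\<open>\<B>\<close> at \<open>(x, - x)\<close> integrates \<open>\<A>\<close> along the line from \<open>(0, - 2 x)\<close>; the value of \<open>\<A>\<close> at
        \<open>(y, y - 2 x)\<close> is traced back to the axis along its own characteristic.\<close>
    have inner_A: "norm (\<A> P y (1 * y + (- 2 * x)))
        \<le> N * exp (\<mu> * (2 * (\<bar>x\<bar> - \<bar>y\<bar>))) + D * exp (\<mu> * (2 * \<bar>x\<bar>))"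
      if y: "y \<in> closed_segment 0 x" for y
    proof -
      have geo: "\<bar>z\<bar> + \<bar>- 1 * z + (2 * y - 2 * x)\<bar> = 2 * (\<bar>x\<bar> - \<bar>y\<bar>) + 2 * \<bar>z\<bar>"
        "\<bar>z\<bar> + \<bar>- 1 * z + (2 * y - 2 * x)\<bar> \<le> 2 * b" if "z \<in> closed_segment 0 y" for z
        using y that x by (auto simp: closed_segment_eq_real_ivl split: if_splits)
      have "norm (\<A> P y (- 1 * y + (2 * y - 2 * x)) - \<A> P 0 (- 1 * 0 + (2 * y - 2 * x)))
        \<le> D * exp (\<mu> * (2 * (\<bar>x\<bar> - \<bar>y\<bar>))) * exp (\<mu> * (2 * \<bar>y\<bar>))
          - D * exp (\<mu> * (2 * (\<bar>x\<bar> - \<bar>y\<bar>))) * exp (\<mu> * (2 * 0))"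
      proof (rule norm_diff_le_growth[OF inb[OF y] A_line[OF inb[OF sub[OF y]]] rB[OF sub[OF y]] phi])
        fix z assume z: "z \<in> closed_segment 0 y"
        show "norm (\<B> P z (- 1 * z + (2 * y - 2 * x))) \<le> C * N * exp (\<mu> * (2 * (\<bar>x\<bar> - \<bar>y\<bar>) + 2 * \<bar>z\<bar>))"
          using diamond(2)[OF inb[OF sub[OF y z]] geo(2)[OF z]] unfolding geo(1)[OF z] .
      qed
      also have "\<dots> \<le> D * exp (\<mu> * (2 * \<bar>x\<bar>))"
        unfolding mult.assoc E using D0 by simp
      finally have "norm (\<A> P y (y - 2 * x) - poly P (of_real (2 * y - 2 * x))) \<le> D * exp (\<mu> * (2 * \<bar>x\<bar>))"
        by (simp add: A_zero)
      moreover have "norm (poly P (of_real (2 * y - 2 * x))) \<le> N * exp (\<mu> * (2 * (\<bar>x\<bar> - \<bar>y\<bar>)))"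
      proof -
        have "\<bar>2 * y - 2 * x\<bar> = 2 * (\<bar>x\<bar> - \<bar>y\<bar>)"
          using y by (auto simp: closed_segment_eq_real_ivl split: if_splits)
        then show ?thesis using bound_N[of "2 * y - 2 * x"] x_le by simp
      qed
      ultimately show ?thesis
        using norm_triangle_sub[of "\<A> P y (y - 2 * x)" "poly P (of_real (2 * y - 2 * x))"] by simp
    qed
    have phi': "((\<lambda>s. R * (- N / (2 * \<mu>) * exp (\<mu> * (2 * (\<bar>x\<bar> - s))) + D * exp (\<mu> * (2 * \<bar>x\<bar>)) * s))
        has_real_derivative R * (N * exp (\<mu> * (2 * (\<bar>x\<bar> - s))) + D * exp (\<mu> * (2 * \<bar>x\<bar>)))) (at s)" for s
      using l by (auto intro!: derivative_eq_intros)
    have "norm (\<B> P x (1 * x + (- 2 * x)) - \<B> P 0 (1 * 0 + (- 2 * x)))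
        \<le> R * (- N / (2 * \<mu>) * exp (\<mu> * (2 * (\<bar>x\<bar> - \<bar>x\<bar>))) + D * exp (\<mu> * (2 * \<bar>x\<bar>)) * \<bar>x\<bar>)
        - R * (- N / (2 * \<mu>) * exp (\<mu> * (2 * (\<bar>x\<bar> - 0))) + D * exp (\<mu> * (2 * \<bar>x\<bar>)) * 0)"
      by (rule norm_diff_le_growth[OF x B_line[OF inb] rA[OF _ inner_A] phi'])
    also have "\<dots> \<le> R * N / (2 * \<mu>) * exp (\<mu> * (2 * \<bar>x\<bar>)) + R * (D * exp (\<mu> * (2 * \<bar>x\<bar>))) * \<bar>x\<bar>"
      using R_pos N0 l by (simp add: algebra_simps)
    also have "\<dots> \<le> R * N / (2 * \<mu>) * exp (\<mu> * (2 * \<bar>x\<bar>)) + R * (D * exp (\<mu> * (2 * \<bar>x\<bar>))) * b"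
      using x R_pos D0 by (intro add_left_mono mult_left_mono) auto
    finally have 3: "norm (\<B> P x (- x)) \<le> R * N / (2 * \<mu>) * exp (\<mu> * (2 * \<bar>x\<bar>)) + R * D * b * exp (\<mu> * (2 * \<bar>x\<bar>))"
      by (simp add: B_zero mult_ac)
    \<comment> \<open>Likewise \<open>\<A>\<close> at \<open>(x, x)\<close> integrates \<open>\<B>\<close> along the line from \<open>(0, 2 x)\<close>.\<close>
    have inner_B: "norm (\<B> P y (- 1 * y + 2 * x)) \<le> D * exp (\<mu> * (2 * \<bar>x\<bar>))"
      if y: "y \<in> closed_segment 0 x" for y
    proof -
      have geo: "\<bar>z\<bar> + \<bar>1 * z + (2 * x - 2 * y)\<bar> = 2 * (\<bar>x\<bar> - \<bar>y\<bar>) + 2 * \<bar>z\<bar>"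
        "\<bar>z\<bar> + \<bar>1 * z + (2 * x - 2 * y)\<bar> \<le> 2 * b" if "z \<in> closed_segment 0 y" for z
        using y that x by (auto simp: closed_segment_eq_real_ivl split: if_splits)
      have "norm (\<B> P y (1 * y + (2 * x - 2 * y)) - \<B> P 0 (1 * 0 + (2 * x - 2 * y)))
        \<le> D * exp (\<mu> * (2 * (\<bar>x\<bar> - \<bar>y\<bar>))) * exp (\<mu> * (2 * \<bar>y\<bar>))
          - D * exp (\<mu> * (2 * (\<bar>x\<bar> - \<bar>y\<bar>))) * exp (\<mu> * (2 * 0))"
      proof (rule norm_diff_le_growth[OF inb[OF y] B_line[OF inb[OF sub[OF y]]] rA[OF sub[OF y]] phi])
        fix z assume z: "z \<in> closed_segment 0 y"
        show "norm (\<A> P z (1 * z + (2 * x - 2 * y))) \<le> C * N * exp (\<mu> * (2 * (\<bar>x\<bar> - \<bar>y\<bar>) + 2 * \<bar>z\<bar>))"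
          using diamond(1)[OF inb[OF sub[OF y z]] geo(2)[OF z]] unfolding geo(1)[OF z] .
      qed
      also have "\<dots> \<le> D * exp (\<mu> * (2 * \<bar>x\<bar>))"
        unfolding mult.assoc E using D0 by simp
      finally show ?thesis by (simp add: B_zero)
    qed
    have phi'': "((\<lambda>s. R * (D * exp (\<mu> * (2 * \<bar>x\<bar>))) * s) has_real_derivative R * (D * exp (\<mu> * (2 * \<bar>x\<bar>)))) (at s)" for s
      by (auto intro!: derivative_eq_intros)
    have "norm (\<A> P x (- 1 * x + 2 * x) - \<A> P 0 (- 1 * 0 + 2 * x))
        \<le> R * (D * exp (\<mu> * (2 * \<bar>x\<bar>))) * \<bar>x\<bar> - R * (D * exp (\<mu> * (2 * \<bar>x\<bar>))) * 0"
      by (rule norm_diff_le_growth[OF x A_line[OF inb] rB[OF _ inner_B] phi''])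
    also have "\<dots> \<le> R * (D * exp (\<mu> * (2 * \<bar>x\<bar>))) * b"
      using x R_pos D0 by (auto intro!: mult_left_mono)
    finally have 4: "norm (\<A> P x x - poly P (of_real (2 * x))) \<le> R * D * b * exp (\<mu> * (2 * \<bar>x\<bar>))"
      by (simp add: A_zero mult_ac)
    have tri: "norm (a - d - e + f + g) \<le> norm a + norm d + norm e + norm f + norm g"
      for a d e f g :: complex
      using norm_triangle_ineq4[of a d] norm_triangle_ineq4[of "a - d" e]
        norm_triangle_ineq[of "a - d - e" f] norm_triangle_ineq[of "a - d - e + f" g] by linarith
    have "poly P (of_real (2 * x)) = char_jump P x
        - (\<A> P x x - poly P (of_real (2 * x))) - \<B> P x x + \<A> P x (- x) + \<B> P x (- x)"
      by (simp add: char_jump_def)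
    also have "norm \<dots> \<le> norm (char_jump P x) + norm (\<A> P x x - poly P (of_real (2 * x)))
        + norm (\<B> P x x) + norm (\<A> P x (- x)) + norm (\<B> P x (- x))"
      by (rule tri)
    also have "\<dots> \<le> \<epsilon> + R * D * b * exp (\<mu> * (2 * \<bar>x\<bar>)) + D * exp (\<mu> * (2 * \<bar>x\<bar>)) + D * exp (\<mu> * (2 * \<bar>x\<bar>))
        + (R * N / (2 * \<mu>) * exp (\<mu> * (2 * \<bar>x\<bar>)) + R * D * b * exp (\<mu> * (2 * \<bar>x\<bar>)))"
      by (intro add_mono jump 1 2 3 4 x)
    also have "\<dots> = \<epsilon> + (2 * D * (1 + b * R) + R * N / (2 * \<mu>)) * exp (\<mu> * (2 * \<bar>x\<bar>))"
      by (simp add: algebra_simps)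
    also have "2 * D * (1 + b * R) + R * N / (2 * \<mu>) = N * (R * C * (1 + b * R) + R / 2) / \<mu>"
      using l by (simp add: D_def field_simps)
    also have "\<dots> = N / 2"
    proof -
      have "R * C * (1 + b * R) + R / 2 = \<mu> / 2" by (simp add: \<mu>_def)
      then show ?thesis using l by (simp only:) simp
    qed
    also have "\<epsilon> + N / 2 * exp (\<mu> * (2 * \<bar>x\<bar>)) \<le> (\<epsilon> + N / 2) * exp (\<mu> * (2 * \<bar>x\<bar>))"
    proof -
      have "\<epsilon> \<ge> 0" using order_trans[OF norm_ge_zero jump[OF x]] .
      then have "\<epsilon> * 1 \<le> \<epsilon> * exp (\<mu> * (2 * \<bar>x\<bar>))" using l by (intro mult_left_mono) auto
      then show ?thesis by (simp add: distrib_right)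
    qed
    finally show ?thesis .
  qed
  have "w \<tau> \<le> \<epsilon> + N / 2" if "\<tau> \<in> {-2*b..2*b}" for \<tau>
    using step[of "\<tau> / 2"] that by (simp add: w_def exp_minus field_simps)
  then have "N \<le> \<epsilon> + N / 2"
    unfolding N_def using b_pos by (intro cSUP_least) (auto simp: N_def)
  then have "N \<le> 2 * \<epsilon>" by simp
  moreover have "exp (\<mu> * \<bar>\<tau>\<bar>) \<le> exp (2 * \<mu> * b)"
    using \<tau> l by (auto simp: abs_le_iff)
  ultimately have N_le: "N * exp (\<mu> * \<bar>\<tau>\<bar>) \<le> 2 * \<epsilon> * exp (2 * \<mu> * b)"
    using N0 by (intro mult_mono) auto
  have "\<bar>\<tau>\<bar> \<le> 2 * b" using \<tau> by auto
  from order_trans[OF bound_N[OF this] N_le]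
  show "norm (poly P (of_real \<tau>)) \<le> 2 * exp (2 * \<mu> * b) * \<epsilon>"
    by (simp add: mult_ac)
qed

end

section \<open>From approximation rates to smoothness\<close>

lemma higher_pderiv_diff: "(pderiv ^^ n) (p - q) = (pderiv ^^ n) p - (pderiv ^^ n) q"
  for p q :: "'a :: idom poly"
  by (induction n) (simp_all add: pderiv_diff)

context wave_system
begin

lemma diagonal_derivatives:
  assumes x: "x \<in> {-b<..<b}"
  shows "((\<lambda>y. \<A> P y y) has_vector_derivative r x * \<B> P x x + 2 * \<A> (pderiv P) x x) (at x)"
    and "((\<lambda>y. \<B> P y y) has_vector_derivative r x * \<A> P x x) (at x)"
    and "((\<lambda>y. \<A> P y (- y)) has_vector_derivative r x * \<B> P x (- x)) (at x)"
    and "((\<lambda>y. \<B> P y (- y)) has_vector_derivative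
           r x * \<A> P x (- x) - 2 * \<B> (pderiv P) x (- x)) (at x)"
proof -
  have at: "at x within {-b..b} = at x"
    using x by (intro at_within_interior) auto
  have xb: "x \<in> {-b..b}" using x by auto
  show "((\<lambda>y. \<A> P y y) has_vector_derivative r x * \<B> P x x + 2 * \<A> (pderiv P) x x) (at x)"
    "((\<lambda>y. \<B> P y y) has_vector_derivative r x * \<A> P x x) (at x)"
    using A_line[OF xb, of P 1 0] B_line[OF xb, of P 1 0] by (simp_all add: at)
  show "((\<lambda>y. \<A> P y (- y)) has_vector_derivative r x * \<B> P x (- x)) (at x)"
    "((\<lambda>y. \<B> P y (- y)) has_vector_derivative
           r x * \<A> P x (- x) - 2 * \<B> (pderiv P) x (- x)) (at x)"
    using A_line[OF xb, of P "- 1" 0] B_line[OF xb, of P "- 1" 0] by (simp_all add: at)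
qed

lemma char_jump_diff: "char_jump (P - Q) x = char_jump P x - char_jump Q x"
  by (simp add: char_jump_def transmute_diff)

text \<open>
  The factor \<open>(2\<^sup>k)\<^sup>p\<^sup>+\<^sup>1\<close> in the rate pays for \<open>p + 1\<close> derivatives of a polynomial of degree
  \<open>2\<^sup>k\<^sup>+\<^sup>1\<close>, and the remaining geometric factor makes the differentiated series converge. The values
  on the two characteristics of these limits are the functions to which the bootstrap applies.
\<close>
lemma potential_regularity:
  fixes P :: "nat \<Rightarrow> complex poly" and q J :: "real \<Rightarrow> complex" and K \<rho> :: real
  assumes deg: "\<And>k. degree (P (Suc k) - P k) \<le> 2 ^ Suc k"
    and P0: "\<And>k. poly (P k) 0 = 0"
    and jump: "\<And>k x. x \<in> {-b..b} \<Longrightarrow>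
        norm (char_jump (P (Suc k) - P k) x) \<le> K * \<rho> ^ k / (2 ^ k) ^ Suc p"
    and rho: "0 \<le> \<rho>" "\<rho> < 1"
    and lim: "\<And>x. x \<in> {-b..b} \<Longrightarrow> (\<lambda>k. char_jump (P k) x) \<longlonglongrightarrow> J x"
    and J: "\<And>x. x \<in> {-b<..<b} \<Longrightarrow> (J has_vector_derivative q x / 2) (at x)"
    and r: "\<And>x. x \<in> {-b<..<b} \<Longrightarrow> (r has_vector_derivative q x - r x * r x) (at x)"
  shows "Ck_on p q {-b<..<b}"
proof (rule Ck_on_locally)
  fix x\<^sub>0 assume x0: "x\<^sub>0 \<in> {-b<..<b}"
  define c where "c = (\<bar>x\<^sub>0\<bar> + b) / 2"
  define T where "T = {-c<..<c}"
  have "\<bar>x\<^sub>0\<bar> < b" using x0 by auto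
  then have "\<bar>x\<^sub>0\<bar> < c" and c: "0 < c" "c < b" by (auto simp: c_def)
  then have x0T: "x\<^sub>0 \<in> T" by (auto simp: T_def)
  have T: "open T" "convex T" and Tb: "\<And>x. x \<in> T \<Longrightarrow> x \<in> {-b<..<b}"
    using c by (auto simp: T_def)
  define D where "D = (\<lambda>k. P (Suc k) - P k)"
  obtain C where C: "C \<ge> 0" and stab: "\<And>P \<epsilon> \<tau>. poly P 0 = 0 \<Longrightarrow>
    (\<And>x. x \<in> {-b..b} \<Longrightarrow> norm (char_jump P x) \<le> \<epsilon>) \<Longrightarrow> \<tau> \<in> {-2*b..2*b} \<Longrightarrow>
    norm (poly P (of_real \<tau>)) \<le> C * \<epsilon>"
    using char_jump_stability by blast
  define \<epsilon> where "\<epsilon> = (\<lambda>k. K * \<rho> ^ k / (2 ^ k) ^ Suc p)"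
  have \<epsilon>: "\<epsilon> k \<ge> 0" for k
    using order_trans[OF norm_ge_zero jump[of 0 k]] b_pos by (simp add: \<epsilon>_def)
  have D: "norm (poly (D k) (of_real \<tau>)) \<le> C * \<epsilon> k" if "\<tau> \<in> {-2*b..2*b}" for k \<tau>
    using stab[OF _ _ that, of "D k" "\<epsilon> k"] P0 jump by (simp add: D_def \<epsilon>_def)
  have geometric: "\<exists>M. \<forall>k x t. x \<in> T \<longrightarrow> \<bar>t\<bar> \<le> c \<longrightarrow>
      norm (\<A> ((pderiv ^^ i) (D k)) x t) \<le> M * \<rho> ^ k \<and> norm (\<B> ((pderiv ^^ i) (D k)) x t) \<le> M * \<rho> ^ k"
    if i: "i \<le> Suc p" for i
  proof -
    obtain Cb where Cb: "Cb \<ge> 0" and bern: "\<And>p :: complex poly. \<And>n M x. degree p \<le> n \<Longrightarrow>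
        (\<forall>x\<in>{-2*b..2*b}. norm (poly p (of_real x)) \<le> M) \<Longrightarrow> x \<in> {-2*c..2*c} \<Longrightarrow>
        norm (poly ((pderiv ^^ i) p) (of_real x)) \<le> Cb * real n ^ i * M"
      using bernstein_inequality_higher[of "2 * c" "2 * b" i] c by (auto simp del: of_nat_power)
    define m where "m = (\<lambda>k. Cb * C * K * 2 ^ Suc p * \<rho> ^ k)"
    have deriv_bound: "norm (poly ((pderiv ^^ i) (D k)) (of_real \<tau>)) \<le> m k" if "\<bar>\<tau>\<bar> \<le> 2 * c" for k \<tau>
    proof -
      have "norm (poly ((pderiv ^^ i) (D k)) (of_real \<tau>)) \<le> Cb * real (2 ^ Suc k) ^ i * (C * \<epsilon> k)"
        using deg D that by (intro bern) (auto simp: D_def)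
      also have "\<dots> \<le> Cb * (2 ^ Suc k) ^ Suc p * (C * \<epsilon> k)"
        using Cb C \<epsilon> i by (intro mult_right_mono mult_left_mono) (auto intro: power_increasing simp del: power_Suc)
      also have "\<dots> = m k"
        by (simp add: m_def \<epsilon>_def power_mult_distrib field_simps)
      finally show ?thesis .
    qed
    have m0: "m k \<ge> 0" for k
      using order_trans[OF norm_ge_zero deriv_bound[of 0 k]] c by simp
    show ?thesis
    proof (intro exI[of _ "2 * (Cb * C * K * 2 ^ Suc p) * exp (2 * R * b)"] allI impI)
      fix k x t assume x: "x \<in> T" and t: "\<bar>t\<bar> \<le> c"
      have "x \<in> {-b..b}" "\<bar>x\<bar> + \<bar>t\<bar> \<le> 2 * c" using x t Tb[OF x] by (auto simp: T_def)
      note AB = wave_bound[OF deriv_bound[where k = k] this]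
      have "2 * m k * exp (2 * R * \<bar>x\<bar>) \<le> 2 * m k * exp (2 * R * b)"
        using m0 R_pos Tb[OF x] by (intro mult_left_mono) auto
      also have "\<dots> = 2 * (Cb * C * K * 2 ^ Suc p) * exp (2 * R * b) * \<rho> ^ k"
        by (simp add: m_def)
      finally show "norm (\<A> ((pderiv ^^ i) (D k)) x t) \<le> 2 * (Cb * C * K * 2 ^ Suc p) * exp (2 * R * b) * \<rho> ^ k \<and>
          norm (\<B> ((pderiv ^^ i) (D k)) x t) \<le> 2 * (Cb * C * K * 2 ^ Suc p) * exp (2 * R * b) * \<rho> ^ k"
        using order_trans[OF AB(1)] order_trans[OF AB(2)] by blast
    qed
  qed
  have uniform: "uniform_limit T (\<lambda>k x. \<A> ((pderiv ^^ i) (P k)) x (\<gamma> x))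
        (\<lambda>x. lim (\<lambda>k. \<A> ((pderiv ^^ i) (P k)) x (\<gamma> x))) sequentially"
      "uniform_limit T (\<lambda>k x. \<B> ((pderiv ^^ i) (P k)) x (\<gamma> x))
        (\<lambda>x. lim (\<lambda>k. \<B> ((pderiv ^^ i) (P k)) x (\<gamma> x))) sequentially"
    if i: "i \<le> Suc p" and \<gamma>: "\<And>x. x \<in> T \<Longrightarrow> \<bar>\<gamma> x\<bar> \<le> c" for i \<gamma>
  proof -
    from geometric[OF i] obtain M where M:
      "\<And>k x t. x \<in> T \<Longrightarrow> \<bar>t\<bar> \<le> c \<Longrightarrow> norm (\<A> ((pderiv ^^ i) (D k)) x t) \<le> M * \<rho> ^ k"
      "\<And>k x t. x \<in> T \<Longrightarrow> \<bar>t\<bar> \<le> c \<Longrightarrow> norm (\<B> ((pderiv ^^ i) (D k)) x t) \<le> M * \<rho> ^ k"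
      by blast
    show "uniform_limit T (\<lambda>k x. \<A> ((pderiv ^^ i) (P k)) x (\<gamma> x))
        (\<lambda>x. lim (\<lambda>k. \<A> ((pderiv ^^ i) (P k)) x (\<gamma> x))) sequentially"
      using M(1) \<gamma> rho by (intro uniform_limit_geometric[where K = M and \<rho> = \<rho>])
        (auto simp: D_def higher_pderiv_diff transmute_diff)
    show "uniform_limit T (\<lambda>k x. \<B> ((pderiv ^^ i) (P k)) x (\<gamma> x))
        (\<lambda>x. lim (\<lambda>k. \<B> ((pderiv ^^ i) (P k)) x (\<gamma> x))) sequentially"
      using M(2) \<gamma> rho by (intro uniform_limit_geometric[where K = M and \<rho> = \<rho>])
        (auto simp: D_def higher_pderiv_diff transmute_diff)
  qed
  have T_abs: "\<bar>x\<bar> \<le> c" "\<bar>- x\<bar> \<le> c" if "x \<in> T" for x using that by (auto simp: T_def)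
  define A where "A = (\<lambda>i x. lim (\<lambda>k. \<A> ((pderiv ^^ i) (P k)) x x))"
  define B where "B = (\<lambda>i x. lim (\<lambda>k. \<B> ((pderiv ^^ i) (P k)) x x))"
  define E where "E = (\<lambda>i x. lim (\<lambda>k. \<A> ((pderiv ^^ i) (P k)) x (- x)))"
  define H where "H = (\<lambda>i x. lim (\<lambda>k. \<B> ((pderiv ^^ i) (P k)) x (- x)))"
  have unif: "uniform_limit T (\<lambda>k x. \<A> ((pderiv ^^ i) (P k)) x x) (A i) sequentially"
    "uniform_limit T (\<lambda>k x. \<B> ((pderiv ^^ i) (P k)) x x) (B i) sequentially"
    "uniform_limit T (\<lambda>k x. \<A> ((pderiv ^^ i) (P k)) x (- x)) (E i) sequentially"
    "uniform_limit T (\<lambda>k x. \<B> ((pderiv ^^ i) (P k)) x (- x)) (H i) sequentially"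
    if "i \<le> Suc p" for i
    unfolding A_def B_def E_def H_def
    by (rule uniform[OF that T_abs(1)] uniform[OF that T_abs(2)]; assumption)+
  note ptw = unif[THEN tendsto_uniform_limitI]
  have r_T: "norm (r x) \<le> R" if "x \<in> T" for x using r_bound[of x] Tb[OF that] by simp
  note r_times = uniform_limit_bounded_factor[where c = r, OF _ r_T]
  have two: "norm ((\<lambda>x. 2) x :: complex) \<le> 2" for x :: real by simp
  note two_times = uniform_limit_bounded_factor[where c = "\<lambda>x. 2", OF _ two]
  note dd = diagonal_derivatives[OF Tb]
  have cont_line: "continuous_on T F" if "\<And>x. x \<in> T \<Longrightarrow> (F has_vector_derivative F' x) (at x)"
    for F F' :: "real \<Rightarrow> complex"
    using that by (intro continuous_on_vector_derivative) (auto intro: has_vector_derivative_at_within)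
  have cont_limit: "continuous_on T G"
    if "uniform_limit T F G sequentially" "\<And>k. continuous_on T (F k)"
    for F :: "nat \<Rightarrow> real \<Rightarrow> complex" and G
    using uniform_limit_theorem[OF _ that(1)] that(2) by simp
  have "Ck_on p q T"
  proof (rule potential_regularity_bootstrap[OF T(1)])
    show "(r has_vector_derivative q x - r x * r x) (at x)" if "x \<in> T" for x
      using r Tb that by blast
    show "continuous_on T (A i) \<and> continuous_on T (B i) \<and> continuous_on T (E i) \<and> continuous_on T (H i)"
      if i: "i \<le> Suc p" for i
      by (intro conjI cont_limit[OF unif(1)[OF i]] cont_limit[OF unif(2)[OF i]]
          cont_limit[OF unif(3)[OF i]] cont_limit[OF unif(4)[OF i]]
          cont_line[OF dd(1)] cont_line[OF dd(2)] cont_line[OF dd(3)] cont_line[OF dd(4)])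
    fix i x assume i: "i \<le> p" and x: "x \<in> T"
    then have i': "i \<le> Suc p" "Suc i \<le> Suc p" by auto
    show "(A i has_vector_derivative r x * B i x + 2 * A (Suc i) x) (at x)"
      by (rule has_vector_derivative_uniform_limit[OF T dd(1) _ ptw(1)[OF i'(1)] x])
        (use uniform_limit_add[OF r_times[OF unif(2)[OF i'(1)]] two_times[OF unif(1)[OF i'(2)]]] in simp_all)
    show "(B i has_vector_derivative r x * A i x) (at x)"
      by (rule has_vector_derivative_uniform_limit[OF T dd(2) _ ptw(2)[OF i'(1)] x])
        (use r_times[OF unif(1)[OF i'(1)]] in simp_all)
    show "(E i has_vector_derivative r x * H i x) (at x)"
      by (rule has_vector_derivative_uniform_limit[OF T dd(3) _ ptw(3)[OF i'(1)] x])
        (use r_times[OF unif(4)[OF i'(1)]] in simp_all)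
    show "(H i has_vector_derivative r x * E i x - 2 * H (Suc i) x) (at x)"
      by (rule has_vector_derivative_uniform_limit[OF T dd(4) _ ptw(4)[OF i'(1)] x])
        (use uniform_limit_minus[OF r_times[OF unif(3)[OF i'(1)]] two_times[OF unif(4)[OF i'(2)]]] in simp_all)
  next
    fix x assume x: "x \<in> T"
    have eq: "J y = A 0 y + B 0 y - E 0 y - H 0 y" if y: "y \<in> T" for y
    proof (rule LIMSEQ_unique[OF lim])
      show "y \<in> {-b..b}" using Tb[OF y] by simp
      show "(\<lambda>k. char_jump (P k) y) \<longlonglongrightarrow> A 0 y + B 0 y - E 0 y - H 0 y"
        unfolding char_jump_def
        using ptw(1)[of 0 y] ptw(2)[of 0 y] ptw(3)[of 0 y] ptw(4)[of 0 y] y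
        by (intro tendsto_intros) simp_all
    qed
    show "((\<lambda>x. A 0 x + B 0 x - E 0 x - H 0 x) has_vector_derivative q x / 2) (at x)"
      using J[OF Tb[OF x]] T(1) x eq by (rule has_vector_derivative_transform_within_open)
  qed
  then show "\<exists>T. open T \<and> x\<^sub>0 \<in> T \<and> Ck_on p q T"
    using T(1) x0T by blast
qed

end

section \<open>The system generated by a nonvanishing solution\<close>

text \<open>
  These are the \<open>\<phi>\<^sub>k\<close> of the Darboux partner, the equation with solution \<open>1 / f\<close> and potential
  \<open>2 (f' / f)\<^sup>2 - q\<close>.
\<close>
definition psi :: "(real \<Rightarrow> complex) \<Rightarrow> nat \<Rightarrow> real \<Rightarrow> complex" where
  "psi f k x = (if odd k then Xt_int f k x / f x else X_int f k x / f x)"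

text \<open>
  Reflecting \<open>t\<close> cancels the even powers and doubles the odd ones.
\<close>
lemma s_fun_eq_appell: "appell (phi f) n x x - appell (phi f) n x (- x) = 2 * s_fun f n x"
proof -
  have eq: "{k. odd k \<and> k \<le> n} = {k \<in> {..n}. odd k}" by auto
  have "s_fun f n x = (\<Sum>k\<le>n. if odd k then of_nat (n choose k) * of_real x ^ k * phi f (n - k) x else 0)"
    unfolding s_fun_def eq by (rule sum.inter_filter) simp
  moreover have "appell (phi f) n x x - appell (phi f) n x (- x)
      = (\<Sum>k\<le>n. 2 * (if odd k then of_nat (n choose k) * of_real x ^ k * phi f (n - k) x else 0))"
    unfolding appell_def sum_subtractf[symmetric] by (intro sum.cong) auto
  ultimately show ?thesis by (simp add: sum_distrib_left)
qed

lemma transmute_half_sum_plus_half_difference: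
  "transmute (\<lambda>k x. (\<eta> k x + \<theta> k x) / 2) P x t + transmute (\<lambda>k x. (\<eta> k x - \<theta> k x) / 2) P x t
    = transmute \<eta> P x t"
proof -
  have "appell (\<lambda>k x. (\<eta> k x + \<theta> k x) / 2) n x t + appell (\<lambda>k x. (\<eta> k x - \<theta> k x) / 2) n x t
      = appell \<eta> n x t" for n
    unfolding appell_def sum.distrib[symmetric] by (intro sum.cong) (auto simp: field_simps)
  then show ?thesis
    unfolding transmute_def sum.distrib[symmetric] distrib_left[symmetric] by simp
qed

locale nonvanishing_solution =
  fixes b :: real and q f f' :: "real \<Rightarrow> complex"
  assumes b_pos: "b > 0"
    and q_cont: "continuous_on {-b..b} q"
    and f_deriv: "x \<in> {-b..b} \<Longrightarrow> (f has_vector_derivative f' x) (at x within {-b..b})"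
    and f'_deriv: "x \<in> {-b..b} \<Longrightarrow> (f' has_vector_derivative q x * f x) (at x within {-b..b})"
    and f_nz: "x \<in> {-b..b} \<Longrightarrow> f x \<noteq> 0"
    and f_zero: "f 0 = 1"
begin

lemma f_cont: "continuous_on {-b..b} f"
  using f_deriv by (rule continuous_on_vector_derivative)

lemma integral_deriv:
  fixes g :: "real \<Rightarrow> complex"
  assumes "continuous_on {-b..b} g" "x \<in> {-b..b}"
  shows "((\<lambda>x. LBINT s=0..x. g s) has_vector_derivative g x) (at x within {-b..b})"
  using interval_integral_FTC2[of "-b" 0 b g x] assms b_pos by (simp add: zero_ereal_def)

lemma weight_cont: "continuous_on {-b..b} (\<lambda>x. (f x)\<^sup>2 powi m)"
  using f_nz by (intro continuous_intros f_cont) auto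

lemma X_int_cont: "continuous_on {-b..b} (X_int f n)" "continuous_on {-b..b} (Xt_int f n)"
proof (induction n)
  case (Suc n)
  { case 1
    show ?case
      unfolding X_int.simps
      by (rule continuous_on_vector_derivative, rule has_vector_derivative_mult_right,
        rule integral_deriv, intro continuous_intros weight_cont Suc) }
  { case 2
    show ?case
      unfolding Xt_int.simps
      by (rule continuous_on_vector_derivative, rule has_vector_derivative_mult_right,
        rule integral_deriv, intro continuous_intros weight_cont Suc) }
qed auto

lemma X_int_deriv:
  assumes "x \<in> {-b..b}"
  shows "(X_int f (Suc n) has_vector_derivative
      of_nat (Suc n) * (X_int f n x * (f x)\<^sup>2 powi ((-1) ^ Suc n))) (at x within {-b..b})"
    and "(Xt_int f (Suc n) has_vector_derivative
      of_nat (Suc n) * (Xt_int f n x * (f x)\<^sup>2 powi ((-1) ^ n))) (at x within {-b..b})"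
  unfolding X_int.simps Xt_int.simps
  by (intro has_vector_derivative_mult_right integral_deriv continuous_intros weight_cont
      X_int_cont assms)+

definition log_deriv :: "real \<Rightarrow> complex" where "log_deriv x = f' x / f x"

lemma inverse_f_deriv:
  assumes "x \<in> {-b..b}"
  shows "((\<lambda>x. 1 / f x) has_vector_derivative - log_deriv x / f x) (at x within {-b..b})"
proof -
  have "((inverse \<circ> f) has_vector_derivative f' x * (- (inverse (f x) ^ Suc (Suc 0)))) (at x within {-b..b})"
    using DERIV_inverse[OF f_nz[OF assms]] f_deriv[OF assms]
    by (intro field_vector_diff_chain_within) (auto intro: has_field_derivative_at_within)
  then show ?thesis
    by (simp add: o_def log_deriv_def field_simps)
qed

lemma log_deriv_riccati:
  assumes "x \<in> {-b..b}"
  shows "(log_deriv has_vector_derivative q x - log_deriv x * log_deriv x) (at x within {-b..b})"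
proof -
  have "((\<lambda>x. f' x * (1 / f x)) has_vector_derivative
      f' x * (- log_deriv x / f x) + q x * f x * (1 / f x)) (at x within {-b..b})"
    by (intro has_vector_derivative_mult f'_deriv inverse_f_deriv assms)
  moreover have "f' x * (- log_deriv x / f x) + q x * f x * (1 / f x) = q x - log_deriv x * log_deriv x"
    using f_nz[OF assms] by (simp add: log_deriv_def field_simps)
  ultimately show ?thesis by (simp add: log_deriv_def[abs_def])
qed

text \<open>
  Differentiating the integral in \<open>\<phi>\<^sub>k\<close> produces the weight \<open>1 / f\<^sup>2\<close> and the one in \<open>\<psi>\<^sub>k\<close> the
  weight \<open>f\<^sup>2\<close>, for either parity of \<open>k\<close>. This turns the factor \<open>f\<close> into \<open>1 / f\<close> and conversely,
  and so exchanges the two families.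
\<close>
lemma phi_psi_deriv:
  assumes x: "x \<in> {-b..b}"
  shows "(phi f k has_vector_derivative log_deriv x * phi f k x + of_nat k * psi f (k - 1) x)
      (at x within {-b..b})" (is ?phi)
    and "(psi f k has_vector_derivative - log_deriv x * psi f k x + of_nat k * phi f (k - 1) x)
      (at x within {-b..b})" (is ?psi)
proof -
  note nz = f_nz[OF x]
  have "?phi \<and> ?psi"
  proof (cases k)
    case 0
    then show ?thesis
      using f_deriv[OF x] inverse_f_deriv[OF x] nz by (simp add: phi_def[abs_def] psi_def[abs_def] log_deriv_def)
  next
    case (Suc n)
    show ?thesis
    proof (cases "even n")
      case True
      then show ?thesis
        using has_vector_derivative_mult[OF f_deriv[OF x] X_int_deriv(1)[OF x, of n]]
          has_vector_derivative_mult[OF inverse_f_deriv[OF x] X_int_deriv(2)[OF x, of n]] nz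
        unfolding Suc
        by (simp add: phi_def[abs_def] psi_def[abs_def] log_deriv_def power_int_minus power2_eq_square field_simps
            del: X_int.simps Xt_int.simps of_nat_Suc)
    next
      case False
      then show ?thesis
        using has_vector_derivative_mult[OF f_deriv[OF x] X_int_deriv(2)[OF x, of n]]
          has_vector_derivative_mult[OF inverse_f_deriv[OF x] X_int_deriv(1)[OF x, of n]] nz
        unfolding Suc
        by (simp add: phi_def[abs_def] psi_def[abs_def] log_deriv_def power_int_minus power2_eq_square field_simps
            del: X_int.simps Xt_int.simps of_nat_Suc)
    qed
  qed
  then show ?phi ?psi by auto
qed

lemma phi_psi_zero:
  "phi f k 0 = (if k = 0 then 1 else 0)" "psi f k 0 = (if k = 0 then 1 else 0)"
  by (cases k; simp add: phi_def psi_def f_zero zero_ereal_def)+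

lemma wave_system_phi_psi:
  obtains R where "wave_system b R log_deriv (\<lambda>k x. (phi f k x + psi f k x) / 2) (\<lambda>k x. (phi f k x - psi f k x) / 2)"
proof -
  have "continuous_on {-b..b} log_deriv"
    using log_deriv_riccati by (rule continuous_on_vector_derivative)
  then have "bounded (log_deriv ` {-b..b})"
    by (intro compact_imp_bounded compact_continuous_image) auto
  then obtain R where "R > 0" and R: "\<And>x. x \<in> {-b..b} \<Longrightarrow> norm (log_deriv x) \<le> R"
    unfolding bounded_pos by auto
  have "wave_system b R log_deriv (\<lambda>k x. (phi f k x + psi f k x) / 2) (\<lambda>k x. (phi f k x - psi f k x) / 2)"
  proof
    fix k x assume x: "x \<in> {-b..b}"
    show "((\<lambda>x. (phi f k x + psi f k x) / 2) has_vector_derivative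
        log_deriv x * ((phi f k x - psi f k x) / 2) + of_nat k * ((phi f (k - 1) x + psi f (k - 1) x) / 2))
        (at x within {-b..b})"
      by (rule has_vector_derivative_eq_rhs[OF has_vector_derivative_divide[OF
            has_vector_derivative_add[OF phi_psi_deriv[OF x]]]]) (simp add: field_simps)
    show "((\<lambda>x. (phi f k x - psi f k x) / 2) has_vector_derivative
        log_deriv x * ((phi f k x + psi f k x) / 2) - of_nat k * ((phi f (k - 1) x - psi f (k - 1) x) / 2))
        (at x within {-b..b})"
      by (rule has_vector_derivative_eq_rhs[OF has_vector_derivative_divide[OF
            has_vector_derivative_diff[OF phi_psi_deriv[OF x]]]]) (simp add: field_simps)
  qed (use b_pos \<open>R > 0\<close> R in \<open>auto simp: phi_psi_zero\<close>)
  then show ?thesis by (rule that)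
qed

end

section \<open>Smoothness of the potential\<close>

theorem theorem7p4:
  fixes b :: real and q f f' :: "real \<Rightarrow> complex" and h :: complex
    and p :: nat and \<delta> c\<^sub>p :: real
  assumes "b > 0"
    and "continuous_on {-b..b} q"
    and "\<And>x. x \<in> {-b..b} \<Longrightarrow> (f has_vector_derivative f' x) (at x within {-b..b})"
    and "\<And>x. x \<in> {-b..b} \<Longrightarrow> (f' has_vector_derivative q x * f x) (at x within {-b..b})"
    and "\<And>x. x \<in> {-b..b} \<Longrightarrow> f x \<noteq> 0"
    and "f 0 = 1"
    and "h = f' 0"
    and "p \<ge> 1" and "\<delta> > 0" and "c\<^sub>p > 0"
    and "\<And>N::nat. N \<ge> 1 \<Longrightarrow>
      \<exists>(a :: nat \<Rightarrow> complex) (\<beta> :: nat \<Rightarrow> complex) (\<epsilon>\<^sub>1 :: real) (\<epsilon>\<^sub>2 :: real).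
        (\<forall>x\<in>{-b..b}.
           norm (h / 2 + 1 / 4 * (LBINT s=0..x. q s) - (\<Sum>n=0..N. a n * c_fun f n x)) < \<epsilon>\<^sub>1 \<and>
           norm (1 / 4 * (LBINT s=0..x. q s) - (\<Sum>n=1..N. \<beta> n * s_fun f n x)) < \<epsilon>\<^sub>2) \<and>
        max \<epsilon>\<^sub>1 \<epsilon>\<^sub>2 \<le> c\<^sub>p / real N powr (real p + 1 + \<delta>)"
  shows "Ck_on p q {-b<..<b}"
proof -
  interpret nonvanishing_solution b q f f'
    using assms(1-6) by unfold_locales
  obtain R where ws: "wave_system b R log_deriv
      (\<lambda>k x. (phi f k x + psi f k x) / 2) (\<lambda>k x. (phi f k x - psi f k x) / 2)"
    by (rule wave_system_phi_psi)
  interpret wave_system b R log_deriv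
    "\<lambda>k x. (phi f k x + psi f k x) / 2" "\<lambda>k x. (phi f k x - psi f k x) / 2"
    by (rule ws)
  have "\<forall>N. \<exists>\<beta> :: nat \<Rightarrow> complex. N \<ge> 1 \<longrightarrow> (\<forall>x\<in>{-b..b}.
      norm (1 / 4 * (LBINT s=0..x. q s) - (\<Sum>n=1..N. \<beta> n * s_fun f n x))
        \<le> c\<^sub>p / real N powr (real p + 1 + \<delta>))"
  proof
    fix N
    show "\<exists>\<beta> :: nat \<Rightarrow> complex. N \<ge> 1 \<longrightarrow> (\<forall>x\<in>{-b..b}.
      norm (1 / 4 * (LBINT s=0..x. q s) - (\<Sum>n=1..N. \<beta> n * s_fun f n x))
        \<le> c\<^sub>p / real N powr (real p + 1 + \<delta>))"
    proof (cases "N \<ge> 1")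
      case True
      from assms(11)[OF this] obtain \<beta> \<epsilon>\<^sub>1 \<epsilon>\<^sub>2 where
        "\<And>x. x \<in> {-b..b} \<Longrightarrow> norm (1 / 4 * (LBINT s=0..x. q s) - (\<Sum>n=1..N. \<beta> n * s_fun f n x)) < \<epsilon>\<^sub>2"
        "max \<epsilon>\<^sub>1 \<epsilon>\<^sub>2 \<le> c\<^sub>p / real N powr (real p + 1 + \<delta>)"
        by blast
      then show ?thesis by (intro exI[of _ \<beta>]) fastforce
    qed simp
  qed
  then obtain \<beta> :: "nat \<Rightarrow> nat \<Rightarrow> complex" where \<beta>: "\<And>N x. N \<ge> 1 \<Longrightarrow> x \<in> {-b..b} \<Longrightarrow>
      norm (1 / 4 * (LBINT s=0..x. q s) - (\<Sum>n=1..N. \<beta> N n * s_fun f n x))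
        \<le> c\<^sub>p / real N powr (real p + 1 + \<delta>)"
    by metis
  \<comment> \<open>Doubling \<open>N\<close> keeps the degree of the difference of consecutive polynomials, at most \<open>2 N\<close>,
      comparable to the \<open>N\<close> in its bound; then the loss from Bernstein's inequality is covered.\<close>
  define P where "P = (\<lambda>k. \<Sum>n=1..2^k. monom (\<beta> (2 ^ k) n) n)"
  define J where "J = (\<lambda>x :: real. 1 / 2 * (LBINT s=0..x. q s))"
  define \<rho> where "\<rho> = 2 powr (- \<delta>)"
  have coeff_P: "coeff (P k) n = (if n \<in> {1..2^k} then \<beta> (2 ^ k) n else 0)" for k n
    by (simp add: P_def coeff_sum)
  have deg_P: "degree (P k) \<le> 2 ^ k" for k
    by (rule degree_le) (simp add: coeff_P)
  have jump_P: "char_jump (P k) x = 2 * (\<Sum>n=1..2^k. \<beta> (2 ^ k) n * s_fun f n x)" for k x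
  proof -
    have "char_jump (P k) x = transmute (phi f) (P k) x x - transmute (phi f) (P k) x (- x)"
      unfolding char_jump_def by (simp flip: transmute_half_sum_plus_half_difference[of "phi f" "psi f"])
    also have "\<dots> = (\<Sum>n\<le>2^k. coeff (P k) n * (2 * s_fun f n x))"
      unfolding transmute_eq_sum[OF deg_P] s_fun_eq_appell[symmetric]
      by (simp add: sum_subtractf right_diff_distrib)
    also have "\<dots> = (\<Sum>n=1..2^k. coeff (P k) n * (2 * s_fun f n x))"
      by (rule sum.mono_neutral_right) (auto simp: coeff_P)
    finally show ?thesis by (simp add: coeff_P sum_distrib_left mult_ac)
  qed
  have powr_dyadic: "real (2 ^ k) powr (real p + 1 + \<delta>) = (2 ^ k) ^ Suc p / \<rho> ^ k" for k
  proof -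
    have "real (2 ^ k) powr (real p + 1 + \<delta>) = (2 ^ k) powr real (Suc p) * (2 ^ k) powr \<delta>"
      by (simp flip: powr_add add: ac_simps)
    also have "(2 ^ k) powr \<delta> = (2 powr \<delta>) ^ k"
      by (simp add: powr_powr mult.commute flip: powr_realpow)
    also have "\<dots> = 1 / \<rho> ^ k" by (simp add: \<rho>_def powr_minus field_simps)
    finally show ?thesis by (subst (asm) powr_realpow) simp_all
  qed
  have err: "norm (J x - char_jump (P k) x) \<le> 2 * c\<^sub>p * \<rho> ^ k / (2 ^ k) ^ Suc p"
    if "x \<in> {-b..b}" for k x
  proof -
    have "J x - char_jump (P k) x
        = 2 * (1 / 4 * (LBINT s=0..x. q s) - (\<Sum>n=1..2^k. \<beta> (2 ^ k) n * s_fun f n x))"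
      by (simp add: J_def jump_P right_diff_distrib)
    then have "norm (J x - char_jump (P k) x)
        = 2 * norm (1 / 4 * (LBINT s=0..x. q s) - (\<Sum>n=1..2^k. \<beta> (2 ^ k) n * s_fun f n x))"
      by (simp only: norm_mult norm_numeral)
    also have "\<dots> \<le> 2 * (c\<^sub>p / real (2 ^ k) powr (real p + 1 + \<delta>))"
      using that by (intro mult_left_mono \<beta>) auto
    finally have "norm (J x - char_jump (P k) x) \<le> 2 * (c\<^sub>p / real (2 ^ k) powr (real p + 1 + \<delta>))" .
    then show ?thesis unfolding powr_dyadic by simp
  qed
  have \<rho>: "0 \<le> \<rho>" "\<rho> < 1"
    using \<open>\<delta> > 0\<close> by (simp_all add: \<rho>_def powr_less_one)
  define err_bound where "err_bound = (\<lambda>k. 2 * c\<^sub>p * \<rho> ^ k / (2 ^ k) ^ Suc p)"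
  have mono: "err_bound (Suc k) \<le> err_bound k" for k
    unfolding err_bound_def using \<rho> \<open>c\<^sub>p > 0\<close>
    by (intro frac_le mult_left_mono power_decreasing power_mono power_increasing) auto
  have lim0: "err_bound \<longlonglongrightarrow> 0"
  proof (rule Lim_null_comparison)
    have "norm (err_bound k) \<le> 2 * c\<^sub>p * \<rho> ^ k" for k
    proof -
      have "err_bound k \<le> 2 * c\<^sub>p * \<rho> ^ k / 1"
        unfolding err_bound_def using \<rho> \<open>c\<^sub>p > 0\<close> by (intro divide_left_mono one_le_power) auto
      then show ?thesis using \<rho> \<open>c\<^sub>p > 0\<close> by (simp add: err_bound_def)
    qed
    then show "\<forall>\<^sub>F k in sequentially. norm (err_bound k) \<le> 2 * c\<^sub>p * \<rho> ^ k" by simp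
    show "(\<lambda>k. 2 * c\<^sub>p * \<rho> ^ k) \<longlonglongrightarrow> 0"
      using \<rho> by (intro tendsto_mult_right_zero LIMSEQ_realpow_zero) auto
  qed
  show ?thesis
  proof (rule potential_regularity)
    show "degree (P (Suc k) - P k) \<le> 2 ^ Suc k" for k
      using deg_P[of k] deg_P[of "Suc k"] by (intro degree_diff_le) auto
    show "poly (P k) 0 = 0" for k
      by (simp add: poly_0_coeff_0 coeff_P)
    show "norm (char_jump (P (Suc k) - P k) x) \<le> 4 * c\<^sub>p * \<rho> ^ k / (2 ^ k) ^ Suc p"
      if x: "x \<in> {-b..b}" for k x
    proof -
      have "char_jump (P (Suc k) - P k) x = (J x - char_jump (P k) x) - (J x - char_jump (P (Suc k)) x)"
        by (simp add: char_jump_diff)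
      also have "norm \<dots> \<le> err_bound k + err_bound (Suc k)"
        unfolding err_bound_def by (intro order_trans[OF norm_triangle_ineq4] add_mono err x)
      also have "\<dots> \<le> 2 * err_bound k" using mono[of k] by simp
      also have "\<dots> = 4 * c\<^sub>p * \<rho> ^ k / (2 ^ k) ^ Suc p" by (simp add: err_bound_def)
      finally show ?thesis .
    qed
    show "(\<lambda>k. char_jump (P k) x) \<longlonglongrightarrow> J x" if x: "x \<in> {-b..b}" for x
    proof -
      have "(\<lambda>k. J x - char_jump (P k) x) \<longlonglongrightarrow> 0"
        using err[OF x] by (intro Lim_null_comparison[OF _ lim0]) (simp add: err_bound_def)
      from tendsto_diff[OF tendsto_const this, of "J x"] show ?thesis by simp
    qed
    fix x assume x: "x \<in> {-b<..<b}"
    then have xb: "x \<in> {-b..b}" and at: "at x within {-b..b} = at x"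
      by (auto intro!: at_within_interior)
    show "(J has_vector_derivative q x / 2) (at x)"
      using has_vector_derivative_mult_right[OF integral_deriv[OF q_cont xb], of "1 / 2"]
      by (simp add: J_def at)
    show "(log_deriv has_vector_derivative q x - log_deriv x * log_deriv x) (at x)"
      using log_deriv_riccati[OF xb] by (simp add: at)
  qed (fact \<rho>)+
qed

end
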